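(* $\mathrm{CON}(\mathrm{THT}^{0})$ is PSPACE-hard.
   Context: Fix a finite set $P$ of atomic propositions. THT formulas over $P$: $\varphi ::= p \mid \bot \mid \varphi\vee\varphi \mid \varphi\wedge\varphi \mid \varphi\rightarrow\varphi \mid \mathsf{X}\varphi \mid \varphi\,\mathsf{U}\,\varphi \mid \varphi\,\mathsf{R}\,\varphi$, plus the modalities $\mathsf F\varphi$ and $\mathsf G\varphi$ with the meaning of $\top\mathsf U\varphi$ and $\bot\mathsf R\varphi$. A THT interpretation is a pair $M=(H,T)$ of infinite words over $2^P$ with $H(i)\subseteq T(i)$ for all $i$; it is total if $H=T$. Satisfaction $M,i\models\varphi$ is defined by: - $M,i\not\models\bot$; - $M,i\models p$ iff $p\in H(i)$; - $\vee$ and $\wedge$ are interpreted as usual; - $M,i\models\varphi\rightarrow\psi$ iff for both $H'\in\{H,T\}$, either $(H',T),i\not\models\varphi$ or $(H',T),i\models\psi$; - the temporal modalities have their usual LTL clauses evaluated in $M$. $M\models\varphi$ means $M,0\models\varphi$. An equilibrium model of $\varphi$ is a total $(T,T)\models\varphi$ such that $(H,T)\not\models\varphi$ whenever $H(i)\subseteq T(i)$ for all $i$ and $H\ne T$. $\mathrm{THT}^0$ is the set of THT formulas containing no implication (hence no negation); all temporal modalities are allowed. $\mathrm{CON}(\mathrm{THT}^0)$ is the problem of deciding whether a given $\mathrm{THT}^0$ formula has an equilibrium model. *)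

theory Defs
  imports Main
begin

text \<open>Atoms are natural numbers (an unbounded supply); F and G are primitive
  because the constant true is not expressible without implication.\<close>

datatype tht =
    Atom nat
  | Bot
  | Or tht tht
  | And tht tht
  | Imp tht tht
  | Next tht
  | Until tht tht
  | Release tht tht
  | Fin tht
  | Glob tht

primrec sat :: "(nat \<Rightarrow> nat set) \<Rightarrow> (nat \<Rightarrow> nat set) \<Rightarrow> nat \<Rightarrow> tht \<Rightarrow> bool" where
  "sat H T i (Atom p) = (p \<in> H i)"
| "sat H T i Bot = False"
| "sat H T i (Or a b) = (sat H T i a \<or> sat H T i b)"
| "sat H T i (And a b) = (sat H T i a \<and> sat H T i b)"
| "sat H T i (Imp a b) = ((sat H T i a \<longrightarrow> sat H T i b) \<and> (sat T T i a \<longrightarrow> sat T T i b))"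
| "sat H T i (Next a) = sat H T (Suc i) a"
| "sat H T i (Until a b) = (\<exists>k\<ge>i. sat H T k b \<and> (\<forall>j. i \<le> j \<and> j < k \<longrightarrow> sat H T j a))"
| "sat H T i (Release a b) = (\<forall>k\<ge>i. sat H T k b \<or> (\<exists>j. i \<le> j \<and> j < k \<and> sat H T j a))"
| "sat H T i (Fin a) = (\<exists>k\<ge>i. sat H T k a)"
| "sat H T i (Glob a) = (\<forall>k\<ge>i. sat H T k a)"

definition equilibrium_model :: "(nat \<Rightarrow> nat set) \<Rightarrow> tht \<Rightarrow> bool" where
  "equilibrium_model T \<phi> \<longleftrightarrow>
     sat T T 0 \<phi> \<and> (\<forall>H. (\<forall>i. H i \<subseteq> T i) \<and> H \<noteq> T \<longrightarrow> \<not> sat H T 0 \<phi>)"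

primrec implication_free :: "tht \<Rightarrow> bool" where
  "implication_free (Atom p) = True"
| "implication_free Bot = True"
| "implication_free (Or a b) = (implication_free a \<and> implication_free b)"
| "implication_free (And a b) = (implication_free a \<and> implication_free b)"
| "implication_free (Imp a b) = False"
| "implication_free (Next a) = implication_free a"
| "implication_free (Until a b) = (implication_free a \<and> implication_free b)"
| "implication_free (Release a b) = (implication_free a \<and> implication_free b)"
| "implication_free (Fin a) = implication_free a"
| "implication_free (Glob a) = implication_free a"

fun nat_code :: "nat \<Rightarrow> bool list" where
  "nat_code n = (if n = 0 then [False] else True # odd n # nat_code (n div 2))"

definition tag :: "nat \<Rightarrow> bool list" where
  "tag k = replicate k True @ [False]"

primrec enc :: "tht \<Rightarrow> bool list" where
  "enc (Atom p) = tag 0 @ nat_code p"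
| "enc Bot = tag 1"
| "enc (Or a b) = tag 2 @ enc a @ enc b"
| "enc (And a b) = tag 3 @ enc a @ enc b"
| "enc (Imp a b) = tag 4 @ enc a @ enc b"
| "enc (Next a) = tag 5 @ enc a"
| "enc (Until a b) = tag 6 @ enc a @ enc b"
| "enc (Release a b) = tag 7 @ enc a @ enc b"
| "enc (Fin a) = tag 8 @ enc a"
| "enc (Glob a) = tag 9 @ enc a"

definition CON_THT0 :: "bool list set" where
  "CON_THT0 = {w. \<exists>\<phi>. w = enc \<phi> \<and> implication_free \<phi> \<and> (\<exists>T. equilibrium_model T \<phi>)}"

text \<open>States are 0..<nstates (0 = start, 1 = accept/halt, 2 = reject);
  tape symbols are 0..<nsyms (0 = blank, 1 = bit False, 2 = bit True);
  moves are -1, 0, 1.\<close>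
record tm =
  nstates :: nat
  nsyms :: nat
  delta :: "nat \<Rightarrow> nat \<Rightarrow> nat \<times> nat \<times> int"

definition wf_tm :: "tm \<Rightarrow> bool" where
  "wf_tm M \<longleftrightarrow> 3 \<le> nstates M \<and> 3 \<le> nsyms M \<and>
     (\<forall>q < nstates M. \<forall>s < nsyms M. case delta M q s of (q', s', d) \<Rightarrow>
        q' < nstates M \<and> s' < nsyms M \<and> d \<in> {-1, 0, 1})"

type_synonym config = "nat \<times> (int \<Rightarrow> nat) \<times> int"

definition bit_sym :: "bool \<Rightarrow> nat" where
  "bit_sym b = (if b then 2 else 1)"

definition step :: "tm \<Rightarrow> config \<Rightarrow> config" where
  "step M c = (case c of (q, t, h) \<Rightarrow>
     if q = 1 \<or> q = 2 then (q, t, h)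
     else (case delta M q (t h) of (q', s', d) \<Rightarrow> (q', t(h := s'), h + d)))"

definition init_config :: "bool list \<Rightarrow> config" where
  "init_config w = (0, (\<lambda>i. if 0 \<le> i \<and> nat i < length w then bit_sym (w ! nat i) else 0), 0)"

definition run :: "tm \<Rightarrow> nat \<Rightarrow> bool list \<Rightarrow> config" where
  "run M n w = (step M ^^ n) (init_config w)"

definition state_of :: "config \<Rightarrow> nat" where "state_of c = fst c"
definition tape_of :: "config \<Rightarrow> int \<Rightarrow> nat" where "tape_of c = fst (snd c)"
definition head_of :: "config \<Rightarrow> int" where "head_of c = snd (snd c)"

definition tape_output :: "(int \<Rightarrow> nat) \<Rightarrow> bool list \<Rightarrow> bool" where
  "tape_output t v \<longleftrightarrow> (\<forall>i < length v. t (int i) = bit_sym (v ! i)) \<and> t (int (length v)) \<notin> {1, 2}"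

definition PSPACE :: "bool list set set" where
  "PSPACE = {L. \<exists>M c k. wf_tm M \<and> (\<forall>w. \<exists>n.
       state_of (run M n w) \<in> {1, 2} \<and>
       (state_of (run M n w) = 1 \<longleftrightarrow> w \<in> L) \<and>
       (\<forall>m \<le> n. \<bar>head_of (run M m w)\<bar> \<le> int (c * length w ^ k + c)))}"

definition poly_time_computable :: "(bool list \<Rightarrow> bool list) \<Rightarrow> bool" where
  "poly_time_computable f \<longleftrightarrow> (\<exists>M c k. wf_tm M \<and> (\<forall>w. \<exists>n \<le> c * length w ^ k + c.
       state_of (run M n w) = 1 \<and> tape_output (tape_of (run M n w)) (f w)))"

definition poly_reducible :: "bool list set \<Rightarrow> bool list set \<Rightarrow> bool" where
  "poly_reducible L L' \<longleftrightarrow> (\<exists>f. poly_time_computable f \<and> (\<forall>w. w \<in> L \<longleftrightarrow> f w \<in> L'))"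

definition PSPACE_hard :: "bool list set \<Rightarrow> bool" where
  "PSPACE_hard L' \<longleftrightarrow> (\<forall>L \<in> PSPACE. poly_reducible L L')"

end

theory Submission
  imports Defs "HOL-Library.Countable"
begin

text \<open>For implication-free formulas, satisfaction in $(H,T)$ depends on $H$ only, so the equilibrium
  models are the minimal models of a monotone temporal formula. Given a machine \<open>M\<close> with polynomial
  space bound \<open>b\<close>, its configurations on an input are written row by row into one infinite word. As the
  head stays away from the ends of a row, the word is determined by its beginning and by a local
  rule relating a letter to the three letters one row earlier, without any row delimiters. Both
  ``the word is an accepting run'' (\<open>C\<close>) and its complement (\<open>E\<close>) are expressible positively for words
  with exactly one letter per position. With a marker \<open>u\<close>, the formula
  \<open>G (some letter) \<and> ((C \<and> G u) \<or> (E \<and> G F u))\<close> has a minimal model iff some word satisfies \<open>C\<close>: the second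
  disjunct never has a minimal model, and it destroys every model that does not arise from an
  accepting run. The encoding of this formula is a prefix code and consists of constant blocks,
  blocks repeated polynomially often, and one block per input bit; it is printed by nested loops over
  the input positions, which a single-tape machine executes with marks on the input cells.\<close>

subsection \<open>Polynomially bounded functions\<close>

definition poly_bounded :: "(nat \<Rightarrow> nat) \<Rightarrow> bool" where
  "poly_bounded g \<longleftrightarrow> (\<exists>c k. \<forall>n. g n \<le> c * n ^ k + c)"

text \<open>The summand 1 covers the base 0, where \<open>0 ^ 0\<close> exceeds every other power.
  The lemma brings two polynomial bounds to a common exponent.\<close>

lemma power_le_power_plus_1:
  assumes "j \<le> k"
  shows "(n::nat) ^ j \<le> n ^ k + 1"
proof (cases "n = 0")
  case False
  then have "n ^ j \<le> n ^ k" using assms by (intro power_increasing) auto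
  then show ?thesis by simp
qed (simp add: power_0_left)

lemma poly_bounded_const: "poly_bounded (\<lambda>n. a)"
  unfolding poly_bounded_def by (rule exI[of _ a], rule exI[of _ 0]) simp

lemma poly_bounded_id: "poly_bounded (\<lambda>n. n)"
  unfolding poly_bounded_def by (rule exI[of _ 1], rule exI[of _ 1]) simp

lemma poly_bounded_add:
  assumes "poly_bounded f" "poly_bounded g"
  shows "poly_bounded (\<lambda>n. f n + g n)"
proof -
  from assms obtain c k d l where f: "\<And>n. f n \<le> c * n ^ k + c" and g: "\<And>n. g n \<le> d * n ^ l + d"
    unfolding poly_bounded_def by blast
  have "f n + g n \<le> (2 * c + 2 * d) * n ^ (k + l) + (2 * c + 2 * d)" for n
  proof -
    have "c * n ^ k \<le> c * (n ^ (k + l) + 1)" "d * n ^ l \<le> d * (n ^ (k + l) + 1)"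
      by (intro mult_le_mono2 power_le_power_plus_1; simp)+
    with f[of n] g[of n] show ?thesis by (simp add: algebra_simps)
  qed
  then show ?thesis unfolding poly_bounded_def by blast
qed

lemma poly_bounded_mult:
  assumes "poly_bounded f" "poly_bounded g"
  shows "poly_bounded (\<lambda>n. f n * g n)"
proof -
  from assms obtain c k d l where f: "\<And>n. f n \<le> c * n ^ k + c" and g: "\<And>n. g n \<le> d * n ^ l + d"
    unfolding poly_bounded_def by blast
  have "f n * g n \<le> (3 * c * d) * n ^ (k + l) + (3 * c * d)" for n
  proof -
    have "f n * g n \<le> (c * n ^ k + c) * (d * n ^ l + d)"
      by (intro mult_le_mono f g)
    also have "\<dots> = c * d * (n ^ (k + l) + n ^ k + n ^ l + 1)"
      by (simp add: algebra_simps power_add)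
    also have "\<dots> \<le> c * d * (3 * n ^ (k + l) + 3)"
      using power_le_power_plus_1[of k "k + l" n] power_le_power_plus_1[of l "k + l" n]
      by (intro mult_le_mono2) simp
    finally show ?thesis by (simp add: algebra_simps)
  qed
  then show ?thesis unfolding poly_bounded_def by blast
qed

subsection \<open>Turing machines over arbitrary finite state and symbol sets\<close>

definition astep :: "('q \<Rightarrow> 'a \<Rightarrow> 'q \<times> 'a \<times> int) \<Rightarrow> 'q \<times> (int \<Rightarrow> 'a) \<times> int \<Rightarrow> 'q \<times> (int \<Rightarrow> 'a) \<times> int" where
  "astep tr c = (case c of (q, t, h) \<Rightarrow> case tr q (t h) of (q', s', d) \<Rightarrow> (q', t(h := s'), h + d))"

text \<open>Only an upper bound on the number of steps is recorded, so branches of different length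
  can be padded to one common bound.\<close>

definition reaches_within ::
    "('q \<Rightarrow> 'a \<Rightarrow> 'q \<times> 'a \<times> int) \<Rightarrow> nat \<Rightarrow> 'q \<times> (int \<Rightarrow> 'a) \<times> int \<Rightarrow> 'q \<times> (int \<Rightarrow> 'a) \<times> int \<Rightarrow> bool" where
  "reaches_within tr n c c' \<longleftrightarrow> (\<exists>m\<le>n. (astep tr ^^ m) c = c')"

lemma reaches_within_trans:
  assumes "reaches_within tr m a b" "reaches_within tr n b c" "m + n \<le> l"
  shows "reaches_within tr l a c"
proof -
  from assms obtain i j where "i \<le> m" "(astep tr ^^ i) a = b" "j \<le> n" "(astep tr ^^ j) b = c"
    unfolding reaches_within_def by blast
  then have "(astep tr ^^ (j + i)) a = c" by (simp add: funpow_add)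
  with \<open>i \<le> m\<close> \<open>j \<le> n\<close> assms(3) show ?thesis
    unfolding reaches_within_def by (intro exI[of _ "j + i"]) simp
qed

lemma reaches_within_mono: "reaches_within tr m a b \<Longrightarrow> m \<le> n \<Longrightarrow> reaches_within tr n a b"
  unfolding reaches_within_def using order_trans by blast

lemma reaches_within_step:
  assumes "tr q (t h) = (q', s', d)" "t(h := s') = t'" "h + d = h'"
  shows "reaches_within tr 1 (q, t, h) (q', t', h')"
  unfolding reaches_within_def by (rule exI[of _ 1]) (use assms in \<open>simp add: astep_def\<close>)

lemma reaches_within_move:
  assumes "tr q (t h) = (q', t h, d)" "h + d = h'"
  shows "reaches_within tr 1 (q, t, h) (q', t, h')"
  using reaches_within_step[of tr q t h q' "t h" d] assms by simp

lemma reaches_within_scan_right: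
  assumes "\<And>j. j < i \<Longrightarrow> tr q (t (int j)) = (q, t (int j), 1)"
  shows "reaches_within tr i (q, t, 0) (q, t, int i)"
  using assms
proof (induction i)
  case 0
  then show ?case by (auto simp: reaches_within_def)
next
  case (Suc i)
  have "reaches_within tr 1 (q, t, int i) (q, t, int (Suc i))"
    by (rule reaches_within_move) (simp_all add: Suc.prems)
  then show ?case
    by (intro reaches_within_trans[OF Suc.IH]) (auto simp: Suc.prems add.commute)
qed

lemma reaches_within_scan_left:
  assumes "\<And>j. j < i \<Longrightarrow> tr q (t (int j)) = (q, t (int j), -1)"
  shows "reaches_within tr i (q, t, int i - 1) (q, t, -1)"
  using assms
proof (induction i)
  case 0
  then show ?case by (auto simp: reaches_within_def)
next
  case (Suc i)
  have "reaches_within tr 1 (q, t, int (Suc i) - 1) (q, t, int i - 1)"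
    by (rule reaches_within_move) (use Suc.prems[of i] in simp_all)
  then show ?case
    by (rule reaches_within_trans[OF _ Suc.IH]) (auto simp: Suc.prems)
qed

text \<open>The machine model reserves the codes 0, 1 and 2, both for states (start, accept, reject)
  and for symbols (blank and the two bits).\<close>

lemma ex_coding_with_prefix:
  assumes "finite A" "a0 \<in> A" "a1 \<in> A" "a2 \<in> A" "distinct [a0, a1, a2]"
  shows "\<exists>f. bij_betw f A {..<card A} \<and> f a0 = (0::nat) \<and> f a1 = 1 \<and> f a2 = 2"
proof -
  obtain zs where zs: "set zs = A - {a0, a1, a2}" "distinct zs"
    using finite_distinct_list[of "A - {a0, a1, a2}"] assms(1) by auto
  define xs where "xs = a0 # a1 # a2 # zs"
  have xs: "set xs = A" "distinct xs" using zs assms by (auto simp: xs_def)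
  have len: "length xs = card A" using xs distinct_card by metis
  have bij: "bij_betw ((!) xs) {..<card A} A"
    using bij_betw_nth[OF xs(2)] xs len by (simp add: lessThan_atLeast0)
  define f where "f = the_inv_into {..<card A} ((!) xs)"
  have f: "i < card A \<Longrightarrow> f (xs ! i) = i" for i
    unfolding f_def using bij by (intro the_inv_into_f_f) (auto simp: bij_betw_def)
  have "3 \<le> card A" using len by (simp add: xs_def)
  then have "f a0 = 0" "f a1 = 1" "f a2 = 2"
    using f[of 0] f[of 1] f[of 2] by (simp_all add: xs_def)
  moreover have "bij_betw f A {..<card A}"
    unfolding f_def by (rule bij_betw_the_inv_into[OF bij])
  ultimately show ?thesis by blast
qed

text \<open>States and symbols are renamed by numbers. Only the finite sets \<open>Q\<close> and
  \<open>S\<close> are coded, since the types themselves may be infinite. By \<open>halt\<close>,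
  \<open>tr\<close> idles exactly where \<open>step\<close> freezes, so the steps correspond one to
  one.\<close>

lemma ex_tm_simulating:
  fixes tr :: "'q \<Rightarrow> 'a \<Rightarrow> 'q \<times> 'a \<times> int"
  assumes Q: "finite Q" "q0 \<in> Q" "q1 \<in> Q" "q2 \<in> Q" "distinct [q0, q1, q2]"
    and S: "finite S" "s0 \<in> S" "s1 \<in> S" "s2 \<in> S" "distinct [s0, s1, s2]"
    and closed: "\<And>q s q' s' d. q \<in> Q \<Longrightarrow> s \<in> S \<Longrightarrow> tr q s = (q', s', d) \<Longrightarrow>
        q' \<in> Q \<and> s' \<in> S \<and> d \<in> {-1, 0, 1}"
    and halt: "\<And>s. tr q1 s = (q1, s, 0)" "\<And>s. tr q2 s = (q2, s, 0)"
  obtains M f g where "wf_tm M" "f q0 = 0" "f q1 = 1" "inj_on g S" "g s0 = 0" "g s1 = 1" "g s2 = 2"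
    "\<And>n q t h. q \<in> Q \<Longrightarrow> range t \<subseteq> S \<Longrightarrow>
       (step M ^^ n) (f q, (\<lambda>j. g (t j)), h) =
         (case (astep tr ^^ n) (q, t, h) of (q', t', h') \<Rightarrow> (f q', (\<lambda>j. g (t' j)), h'))"
proof -
  obtain f where f: "bij_betw f Q {..<card Q}" "f q0 = (0::nat)" "f q1 = 1" "f q2 = 2"
    using ex_coding_with_prefix[OF Q] by blast
  obtain g where g: "bij_betw g S {..<card S}" "g s0 = (0::nat)" "g s1 = 1" "g s2 = 2"
    using ex_coding_with_prefix[OF S] by blast
  define fi where "fi = the_inv_into Q f"
  define gi where "gi = the_inv_into S g"
  have fi: "fi (f q) = q" if "q \<in> Q" for q
    unfolding fi_def using that f(1) by (intro the_inv_into_f_f) (auto simp: bij_betw_def)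
  have gi: "gi (g s) = s" if "s \<in> S" for s
    unfolding gi_def using that g(1) by (intro the_inv_into_f_f) (auto simp: bij_betw_def)
  have fi_in: "fi n \<in> Q" if "n < card Q" for n
    unfolding fi_def using bij_betw_the_inv_into[OF f(1)] that by (auto simp: bij_betw_def)
  have gi_in: "gi n \<in> S" if "n < card S" for n
    unfolding gi_def using bij_betw_the_inv_into[OF g(1)] that by (auto simp: bij_betw_def)
  have f_lt: "f q < card Q" if "q \<in> Q" for q using f(1) that by (auto simp: bij_betw_def)
  have g_lt: "g s < card S" if "s \<in> S" for s using g(1) that by (auto simp: bij_betw_def)
  define M where "M = \<lparr>nstates = card Q, nsyms = card S,
     delta = (\<lambda>q s. case tr (fi q) (gi s) of (q', s', d) \<Rightarrow> (f q', g s', d))\<rparr>"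
  have "3 \<le> card Q" "3 \<le> card S" using f_lt[OF Q(4)] g_lt[OF S(4)] f g by auto
  moreover have "case delta M q s of (q', s', d) \<Rightarrow>
        q' < nstates M \<and> s' < nsyms M \<and> d \<in> {-1, 0, 1}" if "q < nstates M" "s < nsyms M" for q s
  proof (cases "tr (fi q) (gi s)")
    case (fields q' s' d)
    have "q' \<in> Q \<and> s' \<in> S \<and> d \<in> {-1, 0, 1}"
      using that fields by (intro closed[OF fi_in[of q] gi_in[of s]]) (auto simp: M_def)
    then show ?thesis using fields by (auto simp: M_def f_lt g_lt)
  qed
  ultimately have wf: "wf_tm M" by (simp add: wf_tm_def M_def)
  have one: "step M (f q, (\<lambda>j. g (t j)), h) = (case astep tr (q, t, h) of (q', t', h') \<Rightarrow> (f q', (\<lambda>j. g (t' j)), h'))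
      \<and> fst (astep tr (q, t, h)) \<in> Q \<and> range (fst (snd (astep tr (q, t, h)))) \<subseteq> S"
    if q: "q \<in> Q" and t: "range t \<subseteq> S" for q t h
  proof (cases "tr q (t h)")
    case (fields q' s' d)
    have th: "t h \<in> S" using t by auto
    have inQS: "q' \<in> Q" "s' \<in> S" using closed[OF q th fields] by auto
    have "range (t(h := s')) \<subseteq> S" using inQS t by auto
    moreover have "step M (f q, (\<lambda>j. g (t j)), h) = (f q', (\<lambda>j. g ((t(h := s')) j)), h + d)"
    proof (cases "q = q1 \<or> q = q2")
      case True
      then have "q' = q" "s' = t h" "d = 0" using halt fields by auto
      then show ?thesis using True f by (auto simp: step_def fun_eq_iff)
    next
      case False
      \<comment> \<open>Injectivity of \<open>f\<close> on \<open>Q\<close> keeps the halting codes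
        away from all other states.\<close>
      then have "f q \<noteq> 1" "f q \<noteq> 2"
        using f q Q unfolding bij_betw_def inj_on_def by metis+
      then show ?thesis
        using fields by (auto simp: step_def M_def fi[OF q] gi[OF th] fun_eq_iff)
    qed
    ultimately show ?thesis using fields inQS by (simp add: astep_def)
  qed
  have all: "(step M ^^ n) (f q, (\<lambda>j. g (t j)), h) =
         (case (astep tr ^^ n) (q, t, h) of (q', t', h') \<Rightarrow> (f q', (\<lambda>j. g (t' j)), h'))"
    if q: "q \<in> Q" and t: "range t \<subseteq> S" for n q t h
    using that
  proof (induction n arbitrary: q t h)
    case 0
    then show ?case by simp
  next
    case (Suc n)
    obtain q' t' h' where st: "astep tr (q, t, h) = (q', t', h')" by (cases "astep tr (q, t, h)")
    with one[OF Suc.prems, of h] have "step M (f q, (\<lambda>j. g (t j)), h) = (f q', (\<lambda>j. g (t' j)), h')"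
      "q' \<in> Q" "range t' \<subseteq> S" by auto
    with Suc.IH[of q' t' h'] st show ?case
      by (simp only: funpow_Suc_right comp_apply)
  qed
  show thesis
    by (rule that[OF wf f(2,3) _ g(2,3,4) all]) (use g(1) in \<open>auto simp: bij_betw_def\<close>)
qed

subsection \<open>A loop language compiled to Turing machines\<close>

text \<open>The variable of a loop ranges over the positions of the input word; on the tape it is a mark
  on the cell it points to.\<close>

datatype cmd = Skip | Put bool | Seq cmd cmd | For nat cmd | Case nat cmd cmd

primrec out :: "cmd \<Rightarrow> bool list \<Rightarrow> (nat \<rightharpoonup> nat) \<Rightarrow> bool list" where
  "out Skip w e = []"
| "out (Put b) w e = [b]"
| "out (Seq p q) w e = out p w e @ out q w e"
| "out (For v p) w e = concat (map (\<lambda>i. out p w (e(v \<mapsto> i))) [0..<length w])"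
| "out (Case v p q) w e = (if w ! the (e v) then out p w e else out q w e)"

primrec well_scoped :: "nat set \<Rightarrow> cmd \<Rightarrow> bool" where
  "well_scoped V Skip = True"
| "well_scoped V (Put b) = True"
| "well_scoped V (Seq p q) = (well_scoped V p \<and> well_scoped V q)"
| "well_scoped V (For v p) = (v \<notin> V \<and> well_scoped (insert v V) p)"
| "well_scoped V (Case v p q) = (v \<in> V \<and> well_scoped V p \<and> well_scoped V q)"

text \<open>Each unit pays for one sweep of the head over the used tape and back; the extra 1 per
  loop iteration pays for advancing the mark. The same number bounds the output length.\<close>

primrec ops :: "cmd \<Rightarrow> nat \<Rightarrow> nat" where
  "ops Skip n = 1"
| "ops (Put b) n = 1"
| "ops (Seq p q) n = 1 + ops p n + ops q n"
| "ops (For v p) n = 1 + n * (ops p n + 1)"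
| "ops (Case v p q) n = 1 + ops p n + ops q n"

lemma poly_bounded_ops: "poly_bounded (\<lambda>n. ops p n)"
  by (induction p)
     (auto intro!: poly_bounded_add poly_bounded_mult poly_bounded_const poly_bounded_id
       simp del: add_Suc plus_1_eq_Suc One_nat_def)

lemma length_out_le: "length (out p w e) \<le> ops p (length w)"
proof (induction p arbitrary: e)
  case (Seq p q)
  show ?case using Seq.IH(1)[of e] Seq.IH(2)[of e] by simp
next
  case (For v p)
  have "length (out (For v p) w e) = (\<Sum>i\<leftarrow>[0..<length w]. length (out p w (e(v \<mapsto> i))))"
    by (simp add: length_concat comp_def)
  also have "\<dots> \<le> (\<Sum>i\<leftarrow>[0..<length w]. ops p (length w))"
    by (rule sum_list_mono) (rule For.IH)
  finally show ?case by (simp add: sum_list_triv)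
next
  case (Case v p q)
  show ?case using Case.IH(1)[of e] Case.IH(2)[of e] by simp
qed auto

text \<open>\<open>Nxt v p\<close> is a loop whose body has just been executed: it moves the mark of
  \<open>v\<close> one cell on and restarts \<open>p\<close>, or leaves the loop.\<close>

datatype item = Run cmd | Nxt nat cmd

text \<open>\<open>Ret\<close> walks back to cell 0, and \<open>Chk\<close> inspects the cell to the
  right of an erased mark. \<open>Rej\<close> supplies the state with code 2.\<close>

datatype phase = Exec | Ret | Chk | Acc | Rej

text \<open>Three tracks: the input letter, the loop variables pointing to the cell, and the output
  bit already written there.\<close>

type_synonym sym = "nat \<times> nat set \<times> bool option"

text \<open>A control state is a phase together with a continuation. Every item starts and ends with the
  head on cell 0; cell $-1$ is the only blank cell adjacent to the used part of the tape on the
  left, so that it stops the leftward scan of the phase \<open>Ret\<close>. The empty continuation converts the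
  output track into plain bits.\<close>

fun tr :: "phase \<times> item list \<Rightarrow> sym \<Rightarrow> (phase \<times> item list) \<times> sym \<times> int" where
  "tr (Exec, []) (a, m, z) =
     (case z of None \<Rightarrow> ((Acc, []), (0, {}, None), 0)
      | Some b \<Rightarrow> ((Exec, []), (bit_sym b, {}, None), 1))"
| "tr (Exec, Run Skip # K) s = ((Exec, K), s, 0)"
| "tr (Exec, Run (Put b) # K) (a, m, z) =
     (if z = None then ((Ret, K), (a, m, Some b), -1)
      else ((Exec, Run (Put b) # K), (a, m, z), 1))"
| "tr (Exec, Run (Seq p q) # K) s = ((Exec, Run p # Run q # K), s, 0)"
| "tr (Exec, Run (For v p) # K) (a, m, z) =
     (if a = 0 then ((Exec, K), (a, m, z), 0)
      else ((Exec, Run p # Nxt v p # K), (a, insert v m, z), 0))"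
| "tr (Exec, Run (Case v p q) # K) (a, m, z) =
     (if v \<in> m then ((Ret, Run (if a = 2 then p else q) # K), (a, m, z), 0)
      else ((Exec, Run (Case v p q) # K), (a, m, z), 1))"
| "tr (Exec, Nxt v p # K) (a, m, z) =
     (if v \<in> m then ((Chk, Nxt v p # K), (a, m - {v}, z), 1)
      else ((Exec, Nxt v p # K), (a, m, z), 1))"
| "tr (Chk, Nxt v p # K) (a, m, z) =
     (if a = 0 then ((Ret, K), (a, m, z), -1)
      else ((Ret, Run p # Nxt v p # K), (a, insert v m, z), -1))"
| "tr (Ret, K) s = (if s = (0, {}, None) then ((Exec, K), s, 1) else ((Ret, K), s, -1))"
| "tr (x, K) s = ((x, K), s, 0)"

section \<open>Tape contents and correctness of the compiled commands\<close>

definition letter :: "bool list \<Rightarrow> nat \<Rightarrow> nat" where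
  "letter w i = (if i < length w then bit_sym (w ! i) else 0)"

definition cells :: "bool list \<Rightarrow> (nat \<rightharpoonup> nat) \<Rightarrow> bool list \<Rightarrow> int \<Rightarrow> sym" where
  "cells w e z j = (if j < 0 then (0, {}, None)
     else (letter w (nat j), {v. e v = Some (nat j)},
           if nat j < length z then Some (z ! nat j) else None))"

lemma cells_int [simp]:
  "cells w e z (int i) = (letter w i, {v. e v = Some i}, if i < length z then Some (z ! i) else None)"
  by (simp add: cells_def)

lemmas cells_0 [simp] = cells_int[of _ _ _ 0, unfolded of_nat_0]

lemmas cells_Suc [simp] = cells_int[of _ _ _ "Suc _", unfolded of_nat_Suc]

lemma letter_eq_0_iff [simp]: "letter w i = 0 \<longleftrightarrow> length w \<le> i"
  by (auto simp: letter_def bit_sym_def)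

lemma letter_gt_0_iff [simp]: "0 < letter w i \<longleftrightarrow> i < length w"
  by (auto simp: letter_def bit_sym_def)

lemma letter_eq_2_iff: "i < length w \<Longrightarrow> letter w i = 2 \<longleftrightarrow> w ! i"
  by (auto simp: letter_def bit_sym_def)

text \<open>Every cell below \<open>max (length w) (length z)\<close> carries an input letter or an
  output bit, so the scan first meets the fully blank symbol at cell -1.\<close>

lemma return_home:
  assumes "i \<le> max (length w) (length z)"
  shows "reaches_within tr (i + 1) ((Ret, K), cells w e z, int i - 1) ((Exec, K), cells w e z, 0)"
proof (rule reaches_within_trans)
  show "reaches_within tr i ((Ret, K), cells w e z, int i - 1) ((Ret, K), cells w e z, -1)"
    by (rule reaches_within_scan_left) (use assms in auto)
  show "reaches_within tr 1 ((Ret, K), cells w e z, -1) ((Exec, K), cells w e z, 0)"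
    by (rule reaches_within_move) (simp_all add: cells_def)
qed simp

lemma put_correct:
  assumes "length z + 1 \<le> s"
  shows "reaches_within tr (2 * s) ((Exec, Run (Put b) # K), cells w e z, 0) ((Exec, K), cells w e (z @ [b]), 0)"
proof -
  let ?q = "(Exec, Run (Put b) # K)"
  have 1: "reaches_within tr (length z) (?q, cells w e z, 0) (?q, cells w e z, int (length z))"
    by (rule reaches_within_scan_right) simp
  have 2: "reaches_within tr 1 (?q, cells w e z, int (length z))
    ((Ret, K), cells w e (z @ [b]), int (length z) - 1)"
  proof (rule reaches_within_step)
    show "tr ?q (cells w e z (int (length z))) =
        ((Ret, K), (letter w (length z), {v. e v = Some (length z)}, Some b), -1)" by simp
  qed (auto simp: cells_def nth_append fun_eq_iff)
  have 3: "reaches_within tr (length z + 1) ((Ret, K), cells w e (z @ [b]), int (length z) - 1)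
     ((Exec, K), cells w e (z @ [b]), 0)"
    by (rule return_home) simp
  show ?thesis
    by (rule reaches_within_trans[OF reaches_within_trans[OF 1 2 order_refl] 3]) (use assms in simp)
qed

text \<open>Since \<open>e\<close> leaves \<open>v\<close> unassigned, erasing the mark gives back
  the tape of \<open>e\<close>. A blank input letter to the right of the erased mark shows that
  \<open>v\<close> was on the last input position.\<close>

lemma nxt_correct:
  assumes "e v = None" "i < length w" "length w + 1 \<le> s"
  shows "reaches_within tr (2 * s) ((Exec, Nxt v p # K), cells w (e(v \<mapsto> i)) z, 0)
     (if Suc i < length w then ((Exec, Run p # Nxt v p # K), cells w (e(v \<mapsto> Suc i)) z, 0)
      else ((Exec, K), cells w e z, 0))"
proof -
  let ?q = "(Exec, Nxt v p # K)" and ?t = "cells w (e(v \<mapsto> i)) z"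
  have 1: "reaches_within tr i (?q, ?t, 0) (?q, ?t, int i)"
    by (rule reaches_within_scan_right) simp
  obtain a m y where amy: "?t (int i) = (a, m, y)" by (cases "?t (int i)")
  have 2: "reaches_within tr 1 (?q, ?t, int i) ((Chk, Nxt v p # K), cells w e z, int (Suc i))"
  proof (rule reaches_within_step)
    show "tr ?q (?t (int i)) = ((Chk, Nxt v p # K), (a, m - {v}, y), 1)" using amy by auto
    show "?t(int i := (a, m - {v}, y)) = cells w e z"
      using amy assms(1) by (intro ext) (auto simp: cells_def)
  qed simp
  show ?thesis
  proof (cases "Suc i < length w")
    case True
    obtain a m y where amy: "cells w e z (int (Suc i)) = (a, m, y)" by (cases "cells w e z (int (Suc i))")
    have 3: "reaches_within tr 1 ((Chk, Nxt v p # K), cells w e z, int (Suc i))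
      ((Ret, Run p # Nxt v p # K), cells w (e(v \<mapsto> Suc i)) z, int (Suc i) - 1)"
    proof (rule reaches_within_step)
      show "tr (Chk, Nxt v p # K) (cells w e z (int (Suc i))) =
          ((Ret, Run p # Nxt v p # K), (a, insert v m, y), -1)"
        using amy True by (auto simp del: of_nat_Suc)
      show "(cells w e z)(int (Suc i) := (a, insert v m, y)) = cells w (e(v \<mapsto> Suc i)) z"
        using amy assms(1) by (intro ext) (auto simp: cells_def)
    qed simp
    have 4: "reaches_within tr (Suc i + 1) ((Ret, Run p # Nxt v p # K), cells w (e(v \<mapsto> Suc i)) z, int (Suc i) - 1)
      ((Exec, Run p # Nxt v p # K), cells w (e(v \<mapsto> Suc i)) z, 0)"
      by (rule return_home) (use True in simp)
    show ?thesis
      by (simp only: True if_True, rule reaches_within_trans[OF reaches_within_trans[OF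
          reaches_within_trans[OF 1 2 order_refl] 3 order_refl] 4]) (use assms True in simp)
  next
    case False
    have 3: "reaches_within tr 1 ((Chk, Nxt v p # K), cells w e z, int (Suc i))
      ((Ret, K), cells w e z, int (Suc i) - 1)"
      by (rule reaches_within_move[where d = "-1"]) (use False in simp_all)
    have 4: "reaches_within tr (Suc i + 1) ((Ret, K), cells w e z, int (Suc i) - 1)
      ((Exec, K), cells w e z, 0)"
      by (rule return_home) (use assms in simp)
    show ?thesis
      by (simp only: False if_False, rule reaches_within_trans[OF reaches_within_trans[OF
          reaches_within_trans[OF 1 2 order_refl] 3 order_refl] 4]) (use assms in simp)
  qed
qed

lemma case_correct:
  assumes "e v = Some i" "i < length w" "length w + 1 \<le> s"
  shows "reaches_within tr (2 * s) ((Exec, Run (Case v p q) # K), cells w e z, 0)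
     ((Exec, Run (if w ! i then p else q) # K), cells w e z, 0)"
proof -
  let ?q = "(Exec, Run (Case v p q) # K)" and ?r = "Run (if w ! i then p else q) # K"
  have 1: "reaches_within tr i (?q, cells w e z, 0) (?q, cells w e z, int i)"
    by (rule reaches_within_scan_right) (use assms in simp)
  have 2: "reaches_within tr 1 (?q, cells w e z, int i) ((Ret, ?r), cells w e z, int (Suc i) - 1)"
    by (rule reaches_within_move) (use assms in \<open>simp_all add: letter_eq_2_iff\<close>)
  have 3: "reaches_within tr (Suc i + 1) ((Ret, ?r), cells w e z, int (Suc i) - 1) ((Exec, ?r), cells w e z, 0)"
    by (rule return_home) (use assms in simp)
  show ?thesis
    by (rule reaches_within_trans[OF reaches_within_trans[OF 1 2 order_refl] 3]) (use assms in simp)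
qed

text \<open>The bound \<open>s\<close> exceeds the input length plus the length of the output after
  \<open>p\<close>, so the same \<open>s\<close> serves all subcommands, and a sweep costs at most
  \<open>2 * s\<close> steps.\<close>

lemma run_correct:
  assumes "well_scoped (dom e) p" "ran e \<subseteq> {..<length w}"
    and "length w + length (z @ out p w e) + 1 \<le> s"
  shows "reaches_within tr (ops p (length w) * (2 * s))
    ((Exec, Run p # K), cells w e z, 0) ((Exec, K), cells w e (z @ out p w e), 0)"
  using assms
proof (induction p arbitrary: e z K)
  case Skip
  have "reaches_within tr 1 ((Exec, Run Skip # K), cells w e z, 0) ((Exec, K), cells w e z, 0)"
    by (rule reaches_within_move) simp_all
  with Skip show ?case by (auto elim: reaches_within_mono)
next
  case (Put b)
  then show ?case using put_correct[of z s b K w e] by simp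
next
  case (Seq p q)
  have 1: "reaches_within tr 1 ((Exec, Run (Seq p q) # K), cells w e z, 0)
     ((Exec, Run p # Run q # K), cells w e z, 0)"
    by (rule reaches_within_move) simp_all
  have 2: "reaches_within tr (ops p (length w) * (2 * s)) ((Exec, Run p # Run q # K), cells w e z, 0)
     ((Exec, Run q # K), cells w e (z @ out p w e), 0)"
    by (rule Seq.IH(1)) (use Seq.prems in auto)
  have 3: "reaches_within tr (ops q (length w) * (2 * s)) ((Exec, Run q # K), cells w e (z @ out p w e), 0)
     ((Exec, K), cells w e ((z @ out p w e) @ out q w e), 0)"
    by (rule Seq.IH(2)) (use Seq.prems in auto)
  show ?case
    using reaches_within_trans[OF reaches_within_trans[OF 1 2 order_refl] 3] Seq.prems
    by (simp add: algebra_simps)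
next
  case (Case v p q)
  then obtain i where i: "e v = Some i" by auto
  then have lt: "i < length w" using Case.prems(2) by (auto simp: ran_def)
  have 1: "reaches_within tr (2 * s) ((Exec, Run (Case v p q) # K), cells w e z, 0)
     ((Exec, Run (if w ! i then p else q) # K), cells w e z, 0)"
    by (rule case_correct) (use i lt Case.prems in auto)
  show ?case
  proof (cases "w ! i")
    case True
    have 2: "reaches_within tr (ops p (length w) * (2 * s)) ((Exec, Run p # K), cells w e z, 0)
       ((Exec, K), cells w e (z @ out p w e), 0)"
      by (rule Case.IH(1)) (use Case.prems True i in auto)
    show ?thesis
      using 1 2 True i by (auto intro: reaches_within_trans simp: algebra_simps)
  next
    case False
    have 2: "reaches_within tr (ops q (length w) * (2 * s)) ((Exec, Run q # K), cells w e z, 0)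
       ((Exec, K), cells w e (z @ out q w e), 0)"
      by (rule Case.IH(2)) (use Case.prems False i in auto)
    show ?thesis
      using 1 2 False i by (auto intro: reaches_within_trans simp: algebra_simps)
  qed
next
  case (For v p)
  let ?n = "length w"
  let ?o = "\<lambda>i. out p w (e(v \<mapsto> i))"
  let ?tail = "\<lambda>i. concat (map ?o [i..<?n])"
  have ev: "e v = None" using For.prems(1) by auto
  \<comment> \<open>Here \<open>y\<close> is the whole output before iteration \<open>i\<close>; the
    induction is on the number of iterations left.\<close>
  have loop: "reaches_within tr ((?n - i) * (ops p ?n + 1) * (2 * s))
      ((Exec, Run p # Nxt v p # K), cells w (e(v \<mapsto> i)) y, 0) ((Exec, K), cells w e (y @ ?tail i), 0)"
    if "i < ?n" "?n + length (y @ ?tail i) + 1 \<le> s" for i y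
    using that
  proof (induction "?n - i" arbitrary: i y)
    case 0
    then show ?case by simp
  next
    case (Suc d)
    have tail: "?tail i = ?o i @ ?tail (Suc i)" using Suc.prems(1) by (simp add: upt_conv_Cons)
    have 1: "reaches_within tr (ops p ?n * (2 * s)) ((Exec, Run p # Nxt v p # K), cells w (e(v \<mapsto> i)) y, 0)
      ((Exec, Nxt v p # K), cells w (e(v \<mapsto> i)) (y @ ?o i), 0)"
    proof (rule For.IH)
      show "well_scoped (dom (e(v \<mapsto> i))) p" using For.prems(1) by simp
      show "ran (e(v \<mapsto> i)) \<subseteq> {..<?n}" using For.prems(2) Suc.prems(1) ev by simp
      show "?n + length (y @ ?o i) + 1 \<le> s" using Suc.prems(2) unfolding tail by simp
    qed
    note 2 = nxt_correct[of e v i w s p K "y @ ?o i", OF ev Suc.prems(1)]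
    note 12 = reaches_within_trans[OF 1 2 order_refl]
    show ?case
    proof (cases "Suc i < ?n")
      case True
      have 3: "reaches_within tr ((?n - Suc i) * (ops p ?n + 1) * (2 * s))
        ((Exec, Run p # Nxt v p # K), cells w (e(v \<mapsto> Suc i)) (y @ ?o i), 0)
        ((Exec, K), cells w e ((y @ ?o i) @ ?tail (Suc i)), 0)"
        by (rule Suc.hyps(1)) (use Suc True tail in auto)
      have "?n - i = Suc (?n - Suc i)" using Suc.prems by simp
      then have "ops p ?n * (2 * s) + 2 * s + (?n - Suc i) * (ops p ?n + 1) * (2 * s)
          \<le> (?n - i) * (ops p ?n + 1) * (2 * s)"
        by (simp only: mult_Suc add_mult_distrib)
      with 12 3 True Suc.prems show ?thesis
        by (auto simp: tail intro: reaches_within_trans)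
    next
      case False
      then have "?n - i = 1" "?tail (Suc i) = []" using Suc.prems by auto
      with 12 False Suc.prems show ?thesis
        by (simp add: tail algebra_simps)
    qed
  qed
  show ?case
  proof (cases "?n = 0")
    case True
    have "reaches_within tr 1 ((Exec, Run (For v p) # K), cells w e z, int 0) ((Exec, K), cells w e z, int 0)"
      by (rule reaches_within_move) (use True in simp_all)
    then have "reaches_within tr (2 * s) ((Exec, Run (For v p) # K), cells w e z, 0) ((Exec, K), cells w e z, 0)"
      using For.prems(3) by (auto elim: reaches_within_mono)
    with True show ?thesis by simp
  next
    case False
    obtain a m y where amy: "cells w e z (int 0) = (a, m, y)" by (cases "cells w e z (int 0)")
    have "reaches_within tr 1 ((Exec, Run (For v p) # K), cells w e z, int 0)
      ((Exec, Run p # Nxt v p # K), cells w (e(v \<mapsto> 0)) z, int 0)"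
    proof (rule reaches_within_step)
      show "tr (Exec, Run (For v p) # K) (cells w e z (int 0)) =
          ((Exec, Run p # Nxt v p # K), (a, insert v m, y), 0)" using amy False by auto
      show "(cells w e z)(int 0 := (a, insert v m, y)) = cells w (e(v \<mapsto> 0)) z"
        using amy ev by (intro ext) (auto simp: cells_def)
    qed simp
    then have 1: "reaches_within tr 1 ((Exec, Run (For v p) # K), cells w e z, 0)
      ((Exec, Run p # Nxt v p # K), cells w (e(v \<mapsto> 0)) z, 0)" by simp
    from reaches_within_trans[OF 1 loop[of 0 z] order_refl] False For.prems show ?thesis
      by (auto elim!: reaches_within_mono simp: algebra_simps)
  qed
qed

text \<open>The cell behind the output may still hold an input letter or marks. The step into
  \<open>Acc\<close> blanks it, which provides the end of output that \<open>tape_output\<close>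
  demands.\<close>

lemma finish_correct:
  "\<exists>t h. reaches_within tr (length z + 1) ((Exec, []), cells w e z, 0) ((Acc, []), t, h) \<and>
     (\<forall>i < length z. t (int i) = (bit_sym (z ! i), {}, None)) \<and> t (int (length z)) = (0, {}, None)"
proof -
  define conv where "conv i = (\<lambda>j. if 0 \<le> j \<and> j < int i then (bit_sym (z ! nat j), {}, None) else cells w e z j)" for i
  have scan: "reaches_within tr i ((Exec, []), cells w e z, 0) ((Exec, []), conv i, int i)" if "i \<le> length z" for i
    using that
  proof (induction i)
    case 0
    have "conv 0 = cells w e z" by (auto simp: conv_def fun_eq_iff)
    then show ?case by (auto simp: reaches_within_def)
  next
    case (Suc i)
    have "reaches_within tr 1 ((Exec, []), conv i, int i) ((Exec, []), conv (Suc i), int (Suc i))"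
    proof (rule reaches_within_step)
      show "tr (Exec, []) (conv i (int i)) = ((Exec, []), (bit_sym (z ! i), {}, None), 1)"
        using Suc.prems by (simp add: conv_def)
    qed (auto simp: conv_def fun_eq_iff)
    with Suc show ?case by (auto intro: reaches_within_trans)
  qed
  have "reaches_within tr 1 ((Exec, []), conv (length z), int (length z))
    ((Acc, []), (conv (length z))(int (length z) := (0, {}, None)), int (length z))"
  proof (rule reaches_within_step)
    show "tr (Exec, []) (conv (length z) (int (length z))) = ((Acc, []), (0, {}, None), 0)"
      by (simp add: conv_def)
  qed simp_all
  with scan[of "length z"] have "reaches_within tr (length z + 1) ((Exec, []), cells w e z, 0)
    ((Acc, []), (conv (length z))(int (length z) := (0, {}, None)), int (length z))"
    by (auto intro: reaches_within_trans)
  then show ?thesis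
    by (intro exI[of _ "(conv (length z))(int (length z) := (0, {}, None))"] exI[of _ "int (length z)"])
       (auto simp: conv_def)
qed

section \<open>Finiteness of the control and polynomial running time\<close>

text \<open>The continuations that can occur while \<open>p\<close> is executed in front of \<open>K\<close>.\<close>

primrec conts :: "cmd \<Rightarrow> item list \<Rightarrow> item list set" where
  "conts Skip K = {Run Skip # K, K}"
| "conts (Put b) K = {Run (Put b) # K, K}"
| "conts (Seq p q) K = insert (Run (Seq p q) # K) (conts p (Run q # K) \<union> conts q K)"
| "conts (For v p) K = insert (Run (For v p) # K) (insert K (conts p (Nxt v p # K)))"
| "conts (Case v p q) K = insert (Run (Case v p q) # K) (conts p K \<union> conts q K)"

primrec vars :: "cmd \<Rightarrow> nat set" where
  "vars Skip = {}"
| "vars (Put b) = {}"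
| "vars (Seq p q) = vars p \<union> vars q"
| "vars (For v p) = insert v (vars p)"
| "vars (Case v p q) = vars p \<union> vars q"

lemma finite_conts: "finite (conts p K)"
  by (induction p arbitrary: K) auto

lemma finite_vars: "finite (vars p)"
  by (induction p) auto

lemma conts_start: "Run p # K \<in> conts p K"
  by (cases p) auto

lemma conts_end: "K \<in> conts p K"
  by (induction p arbitrary: K) auto

text \<open>The equations mirror those of \<open>tr\<close>: every continuation that a step can
  produce from the given one lies in \<open>C\<close>, and every mark it can set lies in
  \<open>V\<close>.\<close>

fun conts_closed :: "nat set \<Rightarrow> item list set \<Rightarrow> item list \<Rightarrow> bool" where
  "conts_closed V C [] = True"
| "conts_closed V C (Run Skip # K) = (K \<in> C)"
| "conts_closed V C (Run (Put b) # K) = (K \<in> C)"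
| "conts_closed V C (Run (Seq p q) # K) = (Run p # Run q # K \<in> C)"
| "conts_closed V C (Run (For v p) # K) = (v \<in> V \<and> K \<in> C \<and> Run p # Nxt v p # K \<in> C)"
| "conts_closed V C (Run (Case v p q) # K) = (Run p # K \<in> C \<and> Run q # K \<in> C)"
| "conts_closed V C (Nxt v p # K) = (v \<in> V \<and> K \<in> C \<and> Run p # Nxt v p # K \<in> C)"

lemma conts_closed_mono:
  "conts_closed V C L \<Longrightarrow> V \<subseteq> V' \<Longrightarrow> C \<subseteq> C' \<Longrightarrow> conts_closed V' C' L"
  by (induction V C L rule: conts_closed.induct) auto

text \<open>The final continuation \<open>K\<close> is exempt because its successors are not
  governed by \<open>p\<close>; for \<open>K = []\<close> closure is trivial.\<close>

lemma conts_closed_conts: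
  "L \<in> conts p K \<Longrightarrow> L = K \<or> conts_closed (vars p) (conts p K) L"
proof (induction p arbitrary: K L)
  case (Seq p q)
  have q: "L' = K \<or> conts_closed (vars (Seq p q)) (conts (Seq p q) K) L'" if "L' \<in> conts q K" for L'
    using Seq.IH(2)[OF that]
      conts_closed_mono[of "vars q" "conts q K" L' "vars (Seq p q)" "conts (Seq p q) K"] by auto
  consider "L = Run (Seq p q) # K" | "L \<in> conts p (Run q # K)" | "L \<in> conts q K"
    using Seq.prems by auto
  then show ?case
  proof cases
    case 1
    then show ?thesis by (simp add: conts_start)
  next
    case 2
    from Seq.IH(1)[OF this] show ?thesis
    proof
      assume "L = Run q # K"
      then show ?thesis using q conts_start by blast
    qed (use conts_closed_mono[of "vars p" "conts p (Run q # K)" L "vars (Seq p q)" "conts (Seq p q) K"] in auto)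
  next
    case 3
    then show ?thesis by (rule q)
  qed
next
  case (For v p)
  consider "L = Run (For v p) # K" | "L = K" | "L \<in> conts p (Nxt v p # K)"
    using For.prems by auto
  then show ?case
  proof cases
    case 3
    from For.IH[OF this] show ?thesis
      using conts_closed_mono[of "vars p" "conts p (Nxt v p # K)" L "vars (For v p)" "conts (For v p) K"]
      by (auto simp: conts_start)
  qed (auto simp: conts_start)
next
  case (Case v p q)
  consider "L = Run (Case v p q) # K" | "L \<in> conts p K" | "L \<in> conts q K"
    using Case.prems by auto
  then show ?case
  proof cases
    case 2
    from Case.IH(1)[OF this] show ?thesis
      using conts_closed_mono[of "vars p" "conts p K" L "vars (Case v p q)" "conts (Case v p q) K"] by auto
  next
    case 3
    from Case.IH(2)[OF this] show ?thesis
      using conts_closed_mono[of "vars q" "conts q K" L "vars (Case v p q)" "conts (Case v p q) K"] by auto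
  qed (auto simp: conts_start)
qed auto

lemma tr_closed:
  assumes closed: "\<And>L. L \<in> C \<Longrightarrow> conts_closed V C L" and "[] \<in> C"
    and "L \<in> C" "a < 3" "m \<subseteq> V" "tr (x, L) (a, m, z) = ((x', L'), (a', m', z'), d)"
  shows "L' \<in> C \<and> a' < 3 \<and> m' \<subseteq> V \<and> d \<in> {-1, 0, 1}"
proof (cases x)
  case Exec
  show ?thesis
  proof (cases L)
    case Nil
    with Exec assms show ?thesis by (auto simp: bit_sym_def split: option.splits)
  next
    case (Cons i K)
    with closed[OF assms(3)] have cl: "conts_closed V C (i # K)" by simp
    show ?thesis
    proof (cases i)
      case (Run p)
      with cl assms(3-) Exec Cons show ?thesis by (cases p) (auto split: if_splits)
    next
      case (Nxt v p)
      with cl assms(3-) Exec Cons show ?thesis by (auto split: if_splits)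
    qed
  qed
next
  case Ret
  with assms(3-) show ?thesis by (auto split: if_splits)
next
  case Chk
  show ?thesis
  proof (cases "\<exists>v p K. L = Nxt v p # K")
    case True
    with closed[OF assms(3)] assms(3-) Chk show ?thesis by (auto split: if_splits)
  next
    case False
    then have "tr (x, L) (a, m, z) = ((x, L), (a, m, z), 0)"
      using Chk by (cases L; cases "hd L") auto
    with assms(3-) show ?thesis by auto
  qed
qed (use assms(3-) in auto)

theorem poly_time_computable_out:
  assumes "well_scoped {} p"
  shows "poly_time_computable (\<lambda>w. out p w Map.empty)"
proof -
  define C where "C = conts p []"
  define Q where "Q = (UNIV :: phase set) \<times> C"
  define S :: "sym set" where "S = {..<3} \<times> Pow (vars p) \<times> UNIV"
  have closed: "conts_closed (vars p) C L" if "L \<in> C" for L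
    using conts_closed_conts[of L p "[]"] that by (auto simp: C_def)
  have "(UNIV :: phase set) = {Exec, Ret, Chk, Acc, Rej}"
    using phase.exhaust by auto
  then have "finite (UNIV :: phase set)" by (metis finite.emptyI finite_insert)
  then have finQ: "finite Q" by (simp add: Q_def C_def finite_conts)
  have finS: "finite S" by (simp add: S_def finite_vars)
  have inC: "[] \<in> C" "[Run p] \<in> C" by (simp_all add: C_def conts_start conts_end)
  have Q: "(Exec, [Run p]) \<in> Q" "(Acc, []) \<in> Q" "(Rej, []) \<in> Q"
      "distinct [(Exec, [Run p]), (Acc, []), (Rej, [])]"
    using inC by (auto simp: Q_def)
  have S: "(0, {}, None) \<in> S" "(1, {}, None) \<in> S" "(2, {}, None) \<in> S"
      "distinct [(0, {}, None), (1, {}, None), (2, {}, None) :: sym]"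
    by (auto simp: S_def)
  have cl: "q' \<in> Q \<and> s' \<in> S \<and> d \<in> {-1, 0, 1}"
    if "q \<in> Q" "s \<in> S" "tr q s = (q', s', d)" for q s q' s' d
  proof -
    obtain x L where [simp]: "q = (x, L)" by (cases q)
    obtain x' L' where [simp]: "q' = (x', L')" by (cases q')
    obtain a m z where [simp]: "s = (a, m, z)" by (cases s)
    obtain a' m' z' where [simp]: "s' = (a', m', z')" by (cases s')
    show ?thesis
      using that tr_closed[OF closed inC(1), of L a m x z x' L' a' m' z' d] by (simp add: Q_def S_def)
  qed
  obtain M f g where M: "wf_tm M" "f (Exec, [Run p]) = 0" "f (Acc, []) = 1"
      and g: "inj_on g S" "g (0, {}, None) = 0" "g (1, {}, None) = 1" "g (2, {}, None) = 2"
      and sim: "\<And>n q t h. q \<in> Q \<Longrightarrow> range t \<subseteq> S \<Longrightarrow>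
       (step M ^^ n) (f q, (\<lambda>j. g (t j)), h) =
         (case (astep tr ^^ n) (q, t, h) of (q', t', h') \<Rightarrow> (f q', (\<lambda>j. g (t' j)), h'))"
    by (rule ex_tm_simulating[where tr = tr, OF finQ Q finS S cl]) auto
  \<comment> \<open>The first summand bounds the execution of \<open>p\<close>, with the output
    length estimated by \<open>ops p n\<close>; the second bounds the conversion of the output
    track.\<close>
  define time where "time n = ops p n * (2 * (n + ops p n + 1)) + (ops p n + 1)" for n
  have "poly_bounded time"
    unfolding time_def using poly_bounded_ops[of p]
    by (intro poly_bounded_add poly_bounded_mult poly_bounded_const poly_bounded_id)
  then obtain c k where ck: "\<And>n. time n \<le> c * n ^ k + c" unfolding poly_bounded_def by blast
  have "\<exists>n \<le> c * length w ^ k + c. state_of (run M n w) = 1 \<and>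
      tape_output (tape_of (run M n w)) (out p w Map.empty)" for w
  proof -
    let ?z = "out p w Map.empty" and ?t = "cells w Map.empty []"
    have 1: "reaches_within tr (ops p (length w) * (2 * (length w + ops p (length w) + 1)))
        ((Exec, [Run p]), ?t, 0) ((Exec, []), cells w Map.empty ?z, 0)"
      using run_correct[of Map.empty p w "[]" "length w + ops p (length w) + 1" "[]"] assms
        length_out_le[of p w Map.empty] by simp
    obtain t h where 2: "reaches_within tr (length ?z + 1) ((Exec, []), cells w Map.empty ?z, 0) ((Acc, []), t, h)"
        and t: "\<forall>i < length ?z. t (int i) = (bit_sym (?z ! i), {}, None)" "t (int (length ?z)) = (0, {}, None)"
      using finish_correct by blast
    have "reaches_within tr (time (length w)) ((Exec, [Run p]), ?t, 0) ((Acc, []), t, h)"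
      by (rule reaches_within_trans[OF 1 2]) (use length_out_le in \<open>simp add: time_def\<close>)
    then obtain n where n: "n \<le> time (length w)" "(astep tr ^^ n) ((Exec, [Run p]), ?t, 0) = ((Acc, []), t, h)"
      unfolding reaches_within_def by blast
    have rt: "range ?t \<subseteq> S"
      by (auto simp: cells_def S_def letter_def bit_sym_def)
    have "init_config w = (f (Exec, [Run p]), (\<lambda>j. g (?t j)), 0)"
      using M g by (auto simp: init_config_def cells_def letter_def bit_sym_def fun_eq_iff)
    then have run: "run M n w = (1, (\<lambda>j. g (t j)), h)"
      using sim[OF Q(1) rt, of n 0] n M by (simp add: run_def)
    have "tape_output ((\<lambda>j. g (t j))) ?z"
      using t g by (auto simp: tape_output_def bit_sym_def)
    with run have "state_of (run M n w) = 1 \<and> tape_output (tape_of (run M n w)) ?z"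
      by (simp add: state_of_def tape_of_def)
    with n(1) ck[of "length w"] show ?thesis by (meson order_trans)
  qed
  with M(1) show ?thesis unfolding poly_time_computable_def by blast
qed

declare nat_code.simps [simp del]

subsection \<open>Emitting formulas\<close>

definition emittable :: "(bool list \<Rightarrow> bool list) \<Rightarrow> bool" where
  "emittable f \<longleftrightarrow> (\<exists>p. well_scoped {} p \<and> (\<forall>w. out p w Map.empty = f w))"

lemma poly_time_computable_if_emittable: "emittable f \<Longrightarrow> poly_time_computable f"
proof -
  assume "emittable f"
  then obtain p where p: "well_scoped {} p" "\<forall>w. out p w Map.empty = f w"
    unfolding emittable_def by blast
  then have "f = (\<lambda>w. out p w Map.empty)" by auto
  then show ?thesis using poly_time_computable_out[OF p(1)] by simp
qed

definition puts :: "bool list \<Rightarrow> cmd" where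
  "puts s = foldr (\<lambda>b. Seq (Put b)) s Skip"

lemma out_puts [simp]: "out (puts s) w e = s"
  by (induction s) (auto simp: puts_def)

lemma well_scoped_puts [simp]: "well_scoped V (puts s)"
  by (induction s) (auto simp: puts_def)

lemma emittable_const: "emittable (\<lambda>w. s)"
  unfolding emittable_def by (rule exI[of _ "puts s"]) simp

lemma emittable_append:
  assumes "emittable f" "emittable g"
  shows "emittable (\<lambda>w. f w @ g w)"
proof -
  from assms obtain p q where "well_scoped {} p" "\<forall>w. out p w Map.empty = f w"
    "well_scoped {} q" "\<forall>w. out q w Map.empty = g w" unfolding emittable_def by blast
  then show ?thesis unfolding emittable_def by (intro exI[of _ "Seq p q"]) simp
qed

lemma emittable_bits: "emittable (\<lambda>w. concat (map (\<lambda>b. if b then s else t) w))"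
proof -
  have "map (\<lambda>i. if w ! i then s else t) [0..<length w] = map (\<lambda>b. if b then s else t) w" for w
    by (rule nth_equalityI) auto
  then show ?thesis
    unfolding emittable_def by (intro exI[of _ "For 0 (Case 0 (puts s) (puts t))"]) (simp cong: if_cong)
qed

primrec nested_loops :: "nat \<Rightarrow> cmd \<Rightarrow> cmd" where
  "nested_loops 0 p = p"
| "nested_loops (Suc k) p = For k (nested_loops k p)"

lemma concat_replicate_mult:
  "concat (replicate m (concat (replicate n s))) = concat (replicate (m * n) s)"
  by (induction m) (auto simp: replicate_add)

lemma out_nested_loops: "out (nested_loops k (puts s)) w e = concat (replicate (length w ^ k) s)"
proof (induction k arbitrary: e)
  case (Suc k)
  then show ?case by (simp add: map_replicate_const concat_replicate_mult)
qed simp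

lemma well_scoped_nested_loops: "V \<inter> {..<k} = {} \<Longrightarrow> well_scoped V (nested_loops k (puts s))"
proof (induction k arbitrary: V)
  case (Suc k)
  from Suc.prems have "insert k V \<inter> {..<k} = {}" "k \<notin> V" by auto
  then show ?case by (simp add: Suc.IH)
qed simp

text \<open>The constant factor goes into the printed block, and \<open>k\<close> nested loops over
  the input positions provide the power.\<close>

lemma emittable_replicate_power: "emittable (\<lambda>w. concat (replicate (c * length w ^ k + c) s))"
proof -
  let ?s = "concat (replicate c s)"
  have "out (Seq (nested_loops k (puts ?s)) (puts ?s)) w Map.empty
      = concat (replicate (c * length w ^ k + c) s)" for w
    by (simp only: out.simps out_nested_loops out_puts concat_replicate_mult replicate_add concat_append
        mult.commute[of "length w ^ k"])
  then show ?thesis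
    unfolding emittable_def
    by (intro exI[of _ "Seq (nested_loops k (puts ?s)) (puts ?s)"]) (simp add: well_scoped_nested_loops)
qed

text \<open>All blocks are quantified because one number governs the repetition of different blocks,
  such as \<open>Next\<close> tags and encoded letters.\<close>

definition emittable_count :: "(bool list \<Rightarrow> nat) \<Rightarrow> bool" where
  "emittable_count m \<longleftrightarrow> (\<forall>s. emittable (\<lambda>w. concat (replicate (m w) s)))"

lemma emittable_count_const: "emittable_count (\<lambda>w. n)"
  by (simp add: emittable_count_def emittable_const)

lemma emittable_count_length: "emittable_count length"
  unfolding emittable_count_def using emittable_bits[of s s for s] by (simp add: map_replicate_const)

lemma emittable_count_power: "emittable_count (\<lambda>w. c * length w ^ k + c)"
  unfolding emittable_count_def using emittable_replicate_power by blast

lemma emittable_count_add: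
  "emittable_count m \<Longrightarrow> emittable_count n \<Longrightarrow> emittable_count (\<lambda>w. m w + n w)"
  unfolding emittable_count_def by (auto simp: replicate_add intro: emittable_append)

definition emittable_formula :: "(bool list \<Rightarrow> tht) \<Rightarrow> bool" where
  "emittable_formula F \<longleftrightarrow> emittable (\<lambda>w. enc (F w))"

lemma emittable_formula_const: "emittable_formula (\<lambda>w. \<phi>)"
  by (simp add: emittable_formula_def emittable_const)

lemma emittable_formula_Or:
  "emittable_formula F \<Longrightarrow> emittable_formula G \<Longrightarrow> emittable_formula (\<lambda>w. Or (F w) (G w))"
  by (auto simp: emittable_formula_def intro!: emittable_append emittable_const)

lemma emittable_formula_And:
  "emittable_formula F \<Longrightarrow> emittable_formula G \<Longrightarrow> emittable_formula (\<lambda>w. And (F w) (G w))"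
  by (auto simp: emittable_formula_def intro!: emittable_append emittable_const)

lemma emittable_formula_Fin: "emittable_formula F \<Longrightarrow> emittable_formula (\<lambda>w. Fin (F w))"
  by (auto simp: emittable_formula_def intro!: emittable_append emittable_const)

lemma emittable_formula_Glob: "emittable_formula F \<Longrightarrow> emittable_formula (\<lambda>w. Glob (F w))"
  by (auto simp: emittable_formula_def intro!: emittable_append emittable_const)

lemma enc_funpow_Next: "enc ((Next ^^ m) \<phi>) = concat (replicate m (tag 5)) @ enc \<phi>"
  by (induction m) auto

lemma emittable_formula_Next_power:
  "emittable_count m \<Longrightarrow> emittable_formula F \<Longrightarrow> emittable_formula (\<lambda>w. (Next ^^ m w) (F w))"
  by (auto simp: emittable_formula_def emittable_count_def enc_funpow_Next intro!: emittable_append)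

definition disj :: "tht list \<Rightarrow> tht" where
  "disj \<phi>s = foldr Or \<phi>s Bot"

lemma emittable_formula_disj:
  "(\<And>i. i \<in> set xs \<Longrightarrow> emittable_formula (F i)) \<Longrightarrow> emittable_formula (\<lambda>w. disj (map (\<lambda>i. F i w) xs))"
  by (induction xs) (auto simp: disj_def intro!: emittable_formula_const emittable_formula_Or)

lemma sat_disj [simp]: "sat H T i (disj \<phi>s) \<longleftrightarrow> (\<exists>\<phi>\<in>set \<phi>s. sat H T i \<phi>)"
  by (induction \<phi>s) (auto simp: disj_def)

lemma implication_free_disj [simp]:
  "implication_free (disj \<phi>s) \<longleftrightarrow> (\<forall>\<phi>\<in>set \<phi>s. implication_free \<phi>)"
  by (induction \<phi>s) (auto simp: disj_def)

lemma sat_funpow_Next [simp]: "sat H T i ((Next ^^ m) \<phi>) \<longleftrightarrow> sat H T (i + m) \<phi>"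
  by (induction m arbitrary: i) auto

lemma implication_free_funpow_Next [simp]: "implication_free ((Next ^^ m) \<phi>) = implication_free \<phi>"
  by (induction m) auto

subsection \<open>Minimal models of implication-free formulas\<close>

text \<open>Only the clause for \<open>Imp\<close> consults \<open>T\<close>.\<close>

lemma sat_implication_free: "implication_free \<phi> \<Longrightarrow> sat H T i \<phi> \<longleftrightarrow> sat H H i \<phi>"
  by (induction \<phi> arbitrary: i) auto

text \<open>Atom 0 is the marker, set on \<open>U\<close>; it is kept distinct from all letters of
  the alphabet.\<close>

definition word_interp :: "(nat \<Rightarrow> nat) \<Rightarrow> nat set \<Rightarrow> nat \<Rightarrow> nat set" where
  "word_interp x U i = insert (x i) (if i \<in> U then {0} else {})"

text \<open>Both disjuncts require the marker atom 0 infinitely often, but only the first one requires it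
  everywhere. Hence a model containing a word that violates \<open>C\<close>, and so satisfies \<open>E\<close>, can always
  be made smaller by keeping this word only and dropping one occurrence of the marker.\<close>

definition minimality_test :: "nat list \<Rightarrow> tht \<Rightarrow> tht \<Rightarrow> tht" where
  "minimality_test \<Sigma> C E = And (Glob (disj (map Atom \<Sigma>)))
     (Or (And C (Glob (Atom 0))) (And E (Glob (Fin (Atom 0)))))"

lemma ex_equilibrium_model_minimality_test_iff:
  assumes 0: "0 \<notin> set \<Sigma>" and free: "implication_free C" "implication_free E"
    and C: "\<And>x U. range x \<subseteq> set \<Sigma> \<Longrightarrow> sat (word_interp x U) (word_interp x U) 0 C \<longleftrightarrow> P x"
    and E: "\<And>x U. range x \<subseteq> set \<Sigma> \<Longrightarrow> sat (word_interp x U) (word_interp x U) 0 E \<longleftrightarrow> \<not> P x"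
  shows "(\<exists>T. equilibrium_model T (minimality_test \<Sigma> C E)) \<longleftrightarrow> (\<exists>x. range x \<subseteq> set \<Sigma> \<and> P x)"
proof
  assume "\<exists>T. equilibrium_model T (minimality_test \<Sigma> C E)"
  then obtain T where T: "sat T T 0 (minimality_test \<Sigma> C E)"
    and min: "\<And>H. (\<And>i. H i \<subseteq> T i) \<Longrightarrow> H \<noteq> T \<Longrightarrow> \<not> sat H T 0 (minimality_test \<Sigma> C E)"
    unfolding equilibrium_model_def by blast
  from T have "\<forall>i. \<exists>a\<in>set \<Sigma>. a \<in> T i" by (auto simp: minimality_test_def)
  \<comment> \<open>A model may carry several letters at a position; \<open>x\<close> selects one of
    them everywhere.\<close>
  then obtain x where x: "\<And>i. x i \<in> set \<Sigma>" "\<And>i. x i \<in> T i" by metis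
  from T have inf: "\<forall>k. \<exists>l\<ge>k. 0 \<in> T l" by (auto simp: minimality_test_def)
  then obtain l where l: "0 \<in> T l" by blast
  have "P x"
  proof (rule ccontr)
    assume "\<not> P x"
    \<comment> \<open>Removing the single marker at \<open>l\<close> leaves infinitely many others,
      so the second disjunct survives in a strictly smaller interpretation.\<close>
    let ?H = "word_interp x ({i. 0 \<in> T i} - {l})"
    have "\<exists>j\<ge>k. 0 \<in> ?H j" for k
    proof -
      obtain j where "j \<ge> max k (Suc l)" "0 \<in> T j" using inf by blast
      then show ?thesis by (intro exI[of _ j]) (auto simp: word_interp_def)
    qed
    moreover have "sat ?H T 0 E"
      using sat_implication_free[OF free(2), of ?H T] E[of x] x(1) \<open>\<not> P x\<close> by (simp add: image_subset_iff)
    ultimately have "sat ?H T 0 (minimality_test \<Sigma> C E)"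
      using x by (auto simp: minimality_test_def word_interp_def)
    moreover have "?H i \<subseteq> T i" for i
      using x by (auto simp: word_interp_def)
    moreover have "x l \<noteq> 0" using x(1)[of l] 0 by metis
    then have "0 \<notin> ?H l" by (auto simp: word_interp_def)
    with l have "?H \<noteq> T" by metis
    ultimately show False using min by blast
  qed
  with x show "\<exists>x. range x \<subseteq> set \<Sigma> \<and> P x" by blast
next
  assume "\<exists>x. range x \<subseteq> set \<Sigma> \<and> P x"
  then obtain x where x: "range x \<subseteq> set \<Sigma>" "P x" by blast
  let ?T = "word_interp x UNIV"
  have "\<not> sat H ?T 0 (minimality_test \<Sigma> C E)" if H: "\<And>i. H i \<subseteq> ?T i" "H \<noteq> ?T" for H
  proof
    assume sat: "sat H ?T 0 (minimality_test \<Sigma> C E)"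
    have "x i \<in> H i" for i
    proof -
      from sat obtain a where "a \<in> set \<Sigma>" "a \<in> H i" by (auto simp: minimality_test_def)
      with H(1)[of i] 0 show ?thesis by (auto simp: word_interp_def)
    qed
    \<comment> \<open>The letters being forced, \<open>H\<close> can differ from \<open>?T\<close>
      only in the marker, on which the truth of \<open>E\<close> does not depend.\<close>
    then have "H = word_interp x {i. 0 \<in> H i}"
      using H(1) by (auto simp: word_interp_def fun_eq_iff)
    moreover from sat consider "\<forall>i. 0 \<in> H i" | "sat H ?T 0 E"
      by (auto simp: minimality_test_def)
    then show False
    proof cases
      case 1
      then have "{i. 0 \<in> H i} = UNIV" by auto
      with calculation H(2) show ?thesis by simp
    next
      case 2
      then have "sat H H 0 E" using sat_implication_free[OF free(2)] by blast
      then show ?thesis using calculation E[OF x(1)] x(2) by metis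
    qed
  qed
  moreover have "sat ?T ?T 0 (minimality_test \<Sigma> C E)"
    using C[OF x(1)] x range_subsetD[OF x(1)] by (auto simp: minimality_test_def word_interp_def)
  ultimately show "\<exists>T. equilibrium_model T (minimality_test \<Sigma> C E)"
    unfolding equilibrium_model_def by blast
qed

subsection \<open>Formulas for runs of a cellular automaton on a helix\<close>

text \<open>Positive substitute for a negated atom: with exactly one letter per position, not
  carrying \<open>a\<close> means carrying another letter.\<close>

definition others :: "nat list \<Rightarrow> nat \<Rightarrow> tht" where
  "others \<Sigma> a = disj (map Atom (filter (\<lambda>b. b \<noteq> a) \<Sigma>))"

text \<open>Nesting \<open>Next\<close> instead of using its powers makes the encoding a sequence of
  blocks, each depending on one letter only, and keeps its length linear in that of
  \<open>as\<close>.\<close>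

definition starts_with :: "nat list \<Rightarrow> nat \<Rightarrow> tht" where
  "starts_with as z = foldr (\<lambda>a \<phi>. And (Atom a) (Next \<phi>)) as (Atom z)"

definition not_starts_with :: "nat list \<Rightarrow> nat list \<Rightarrow> nat \<Rightarrow> tht" where
  "not_starts_with \<Sigma> as z = foldr (\<lambda>a \<phi>. Or (others \<Sigma> a) (Next \<phi>)) as (others \<Sigma> z)"

text \<open>On a word exactly one triple matches at each position, so this disjunction acts as a
  case distinction, and negating it amounts to negating \<open>G\<close> alone.\<close>

definition windows :: "nat list \<Rightarrow> (nat \<Rightarrow> nat \<Rightarrow> nat \<Rightarrow> tht) \<Rightarrow> nat \<Rightarrow> tht" where
  "windows \<Sigma> G m = disj (map (\<lambda>(a, b, c). And (Atom a) (And (Next (Atom b))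
     (And (Next (Next (Atom c))) ((Next ^^ m) (G a b c))))) (List.product \<Sigma> (List.product \<Sigma> \<Sigma>)))"

definition run_formula :: "nat list \<Rightarrow> (nat \<Rightarrow> nat \<Rightarrow> nat \<Rightarrow> nat) \<Rightarrow> (nat \<Rightarrow> bool) \<Rightarrow> nat list \<Rightarrow> nat \<Rightarrow> nat \<Rightarrow> tht" where
  "run_formula \<Sigma> r A as z m = And (starts_with as z)
     (And (Glob (windows \<Sigma> (\<lambda>a b c. Atom (r a b c)) m)) (Fin (disj (map Atom (filter A \<Sigma>)))))"

definition no_run_formula :: "nat list \<Rightarrow> (nat \<Rightarrow> nat \<Rightarrow> nat \<Rightarrow> nat) \<Rightarrow> (nat \<Rightarrow> bool) \<Rightarrow> nat list \<Rightarrow> nat \<Rightarrow> nat \<Rightarrow> tht" where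
  "no_run_formula \<Sigma> r A as z m = Or (not_starts_with \<Sigma> as z)
     (Or (Fin (windows \<Sigma> (\<lambda>a b c. others \<Sigma> (r a b c)) m)) (Glob (disj (map Atom (filter (\<lambda>a. \<not> A a) \<Sigma>)))))"

text \<open>For rows of length \<open>m - 1\<close>, position \<open>p + m\<close> lies exactly one
  row below \<open>p + 1\<close>, the middle of the window.\<close>

definition accepting_word :: "(nat \<Rightarrow> nat \<Rightarrow> nat \<Rightarrow> nat) \<Rightarrow> (nat \<Rightarrow> bool) \<Rightarrow> nat list \<Rightarrow> nat \<Rightarrow> nat \<Rightarrow> (nat \<Rightarrow> nat) \<Rightarrow> bool" where
  "accepting_word r A as z m x \<longleftrightarrow> (\<forall>j < length as. x j = as ! j) \<and> x (length as) = z \<and>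
     (\<forall>p. x (p + m) = r (x p) (x (p + 1)) (x (p + 2))) \<and> (\<exists>p. A (x p))"

lemma sat_others:
  assumes "range x \<subseteq> set \<Sigma>" "0 \<notin> set \<Sigma>"
  shows "sat (word_interp x U) T i (others \<Sigma> a) \<longleftrightarrow> x i \<noteq> a"
  using assms by (auto simp: others_def word_interp_def split: if_splits)

lemma sat_starts_with:
  assumes "0 \<notin> set as" "z \<noteq> 0"
  shows "sat (word_interp x U) T i (starts_with as z) \<longleftrightarrow>
    (\<forall>j < length as. x (i + j) = as ! j) \<and> x (i + length as) = z"
  using assms
proof (induction as arbitrary: i)
  case Nil
  then show ?case by (auto simp: starts_with_def word_interp_def)
next
  case (Cons a as)
  have "sat (word_interp x U) T i (starts_with (a # as) z) \<longleftrightarrow>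
      x i = a \<and> sat (word_interp x U) T (Suc i) (starts_with as z)"
    using Cons.prems by (auto simp: starts_with_def word_interp_def)
  with Cons show ?case by (auto simp: All_less_Suc2)
qed

lemma sat_not_starts_with:
  assumes "range x \<subseteq> set \<Sigma>" "0 \<notin> set \<Sigma>"
  shows "sat (word_interp x U) T i (not_starts_with \<Sigma> as z) \<longleftrightarrow>
    \<not> ((\<forall>j < length as. x (i + j) = as ! j) \<and> x (i + length as) = z)"
proof (induction as arbitrary: i)
  case Nil
  then show ?case by (auto simp: not_starts_with_def sat_others[OF assms])
next
  case (Cons a as)
  have "sat (word_interp x U) T i (not_starts_with \<Sigma> (a # as) z) \<longleftrightarrow>
      x i \<noteq> a \<or> sat (word_interp x U) T (Suc i) (not_starts_with \<Sigma> as z)"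
    by (auto simp: not_starts_with_def sat_others[OF assms])
  with Cons show ?case by (auto simp: All_less_Suc2)
qed

lemma sat_windows:
  assumes "range x \<subseteq> set \<Sigma>" "0 \<notin> set \<Sigma>"
  shows "sat (word_interp x U) T i (windows \<Sigma> G m) \<longleftrightarrow>
    sat (word_interp x U) T (i + m) (G (x i) (x (i + 1)) (x (i + 2)))"
proof
  have in_iff: "a \<in> word_interp x U j \<longleftrightarrow> a = x j" if "a \<in> set \<Sigma>" for a j
    using that assms(2) by (auto simp: word_interp_def)
  assume "sat (word_interp x U) T i (windows \<Sigma> G m)"
  then obtain a b c where "a \<in> set \<Sigma>" "b \<in> set \<Sigma>" "c \<in> set \<Sigma>"
    "a \<in> word_interp x U i" "b \<in> word_interp x U (Suc i)" "c \<in> word_interp x U (Suc (Suc i))"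
    "sat (word_interp x U) T (i + m) (G a b c)"
    by (auto simp: windows_def)
  then show "sat (word_interp x U) T (i + m) (G (x i) (x (i + 1)) (x (i + 2)))"
    by (simp add: in_iff)
next
  assume "sat (word_interp x U) T (i + m) (G (x i) (x (i + 1)) (x (i + 2)))"
  moreover have "(x i, x (i + 1), x (i + 2)) \<in> set (List.product \<Sigma> (List.product \<Sigma> \<Sigma>))"
    using range_subsetD[OF assms(1)] by simp
  ultimately show "sat (word_interp x U) T i (windows \<Sigma> G m)"
    unfolding windows_def sat_disj set_map bex_simps
    by (intro bexI[of _ "(x i, x (i + 1), x (i + 2))"]) (simp_all add: word_interp_def)
qed

lemma sat_disj_filter:
  assumes "range x \<subseteq> set \<Sigma>" "0 \<notin> set \<Sigma>"
  shows "sat (word_interp x U) T i (disj (map Atom (filter A \<Sigma>))) \<longleftrightarrow> A (x i)"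
  using assms by (auto simp: word_interp_def split: if_splits)

lemma implication_free_others: "implication_free (others \<Sigma> a)"
  by (auto simp: others_def)

lemma implication_free_starts_with: "implication_free (starts_with as z)"
  by (induction as) (auto simp: starts_with_def)

lemma implication_free_not_starts_with: "implication_free (not_starts_with \<Sigma> as z)"
  by (induction as) (auto simp: not_starts_with_def implication_free_others)

lemma implication_free_run_formula: "implication_free (run_formula \<Sigma> r A as z m)"
  by (auto simp: run_formula_def windows_def implication_free_starts_with)

lemma implication_free_no_run_formula: "implication_free (no_run_formula \<Sigma> r A as z m)"
  by (auto simp: no_run_formula_def windows_def implication_free_not_starts_with implication_free_others)

lemma ex_equilibrium_model_run_formula_iff:
  assumes "0 \<notin> set \<Sigma>" "0 \<notin> set as" "z \<noteq> 0" "\<And>a b c. r a b c \<noteq> 0"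
  shows "(\<exists>T. equilibrium_model T (minimality_test \<Sigma> (run_formula \<Sigma> r A as z m) (no_run_formula \<Sigma> r A as z m)))
    \<longleftrightarrow> (\<exists>x. range x \<subseteq> set \<Sigma> \<and> accepting_word r A as z m x)"
proof (rule ex_equilibrium_model_minimality_test_iff)
  fix x :: "nat \<Rightarrow> nat" and U
  assume x: "range x \<subseteq> set \<Sigma>"
  have atom: "a \<in> word_interp x U j \<longleftrightarrow> x j = a" if "a \<noteq> 0" for a j
    using that by (auto simp: word_interp_def)
  note eval = sat_starts_with[OF assms(2,3)] sat_not_starts_with[OF x assms(1)] sat_windows[OF x assms(1)]
    sat_disj_filter[OF x assms(1)] sat_others[OF x assms(1)]
  show "sat (word_interp x U) (word_interp x U) 0 (run_formula \<Sigma> r A as z m) \<longleftrightarrow> accepting_word r A as z m x"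
    using assms(4) by (simp add: run_formula_def accepting_word_def eval atom del: sat_disj)
  show "sat (word_interp x U) (word_interp x U) 0 (no_run_formula \<Sigma> r A as z m) \<longleftrightarrow> \<not> accepting_word r A as z m x"
    by (simp add: no_run_formula_def accepting_word_def eval del: sat_disj)
qed (fact assms(1) implication_free_run_formula implication_free_no_run_formula)+

text \<open>In prefix notation each application of \<open>G\<close> only puts a block in front, so
  the code of the whole chain is a concatenation of blocks.\<close>

lemma emittable_formula_chain:
  assumes "\<And>a \<phi>. enc (G a \<phi>) = block a @ enc \<phi>" "emittable (\<lambda>w. concat (map block (as w)))"
  shows "emittable_formula (\<lambda>w. foldr G (as w) \<phi>)"
proof -
  have "enc (foldr G bs \<phi>) = concat (map block bs) @ enc \<phi>" for bs
    by (induction bs) (auto simp: assms(1))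
  then show ?thesis
    using emittable_append[OF assms(2) emittable_const[of "enc \<phi>"]] by (simp add: emittable_formula_def)
qed

lemma emittable_formula_windows:
  assumes "emittable_count m"
  shows "emittable_formula (\<lambda>w. windows \<Sigma> G (m w))"
  unfolding windows_def case_prod_unfold
  by (intro emittable_formula_disj emittable_formula_And emittable_formula_const
      emittable_formula_Next_power assms)

lemma emittable_formula_minimality_test_run:
  assumes "\<And>block. emittable (\<lambda>w. concat (map block (as w)))" "emittable_count m"
  shows "emittable_formula (\<lambda>w. minimality_test \<Sigma> (run_formula \<Sigma> r A (as w) z (m w)) (no_run_formula \<Sigma> r A (as w) z (m w)))"
proof -
  have "emittable_formula (\<lambda>w. starts_with (as w) z)"
    unfolding starts_with_def
    by (rule emittable_formula_chain[where block = "\<lambda>a. tag 3 @ enc (Atom a) @ tag 5", OF _ assms(1)]) simp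
  moreover have "emittable_formula (\<lambda>w. not_starts_with \<Sigma> (as w) z)"
    unfolding not_starts_with_def
    by (rule emittable_formula_chain[where block = "\<lambda>a. tag 2 @ enc (others \<Sigma> a) @ tag 5", OF _ assms(1)]) simp
  ultimately show ?thesis
    unfolding minimality_test_def run_formula_def no_run_formula_def
    by (intro emittable_formula_And emittable_formula_Or emittable_formula_Glob emittable_formula_Fin
        emittable_formula_windows emittable_formula_const assms)
qed

subsection \<open>Space-bounded computations as words\<close>

text \<open>The additional state \<open>nstates M\<close> moves from cell $-1$ to the start of the input. As a
  consequence, in the initial configuration all letters of the input are encoded uniformly.\<close>

definition act :: "tm \<Rightarrow> nat \<Rightarrow> nat \<Rightarrow> nat \<times> nat \<times> int" where
  "act M q s = (if q = nstates M then (0, s, 1) else if q = 1 \<or> q = 2 then (q, s, 0) else delta M q s)"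

definition departing :: "tm \<Rightarrow> int \<Rightarrow> nat option \<times> nat \<Rightarrow> nat option" where
  "departing M d a = (case a of (None, s) \<Rightarrow> None
     | (Some q, s) \<Rightarrow> (case act M q s of (q', s', d') \<Rightarrow> if d' = d then Some q' else None))"

definition rule :: "tm \<Rightarrow> nat option \<times> nat \<Rightarrow> nat option \<times> nat \<Rightarrow> nat option \<times> nat \<Rightarrow> nat option \<times> nat" where
  "rule M a b c =
     (case departing M 0 b of Some q \<Rightarrow> Some q
      | None \<Rightarrow> (case departing M 1 a of Some q \<Rightarrow> Some q | None \<Rightarrow> departing M (-1) c),
      case b of (None, s) \<Rightarrow> s | (Some q, s) \<Rightarrow> fst (snd (act M q s)))"

definition cell :: "config \<Rightarrow> int \<Rightarrow> nat option \<times> nat" where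
  "cell c j = (if head_of c = j then Some (state_of c) else None, tape_of c j)"

lemma departing_None [simp]: "fst a = None \<Longrightarrow> departing M d a = None"
  by (cases a) (simp add: departing_def)

lemma rule_cong_outer:
  assumes "a = a' \<or> fst a = None \<and> fst a' = None" "c = c' \<or> fst c = None \<and> fst c' = None"
  shows "rule M a b c = rule M a' b c'"
proof -
  have "departing M 1 a = departing M 1 a'" "departing M (-1) c = departing M (-1) c'"
    using assms by auto
  then show ?thesis by (simp add: rule_def cong: option.case_cong)
qed

lemma cell_astep:
  assumes "snd (snd (act M q (t h))) \<in> {-1, 0, 1}"
  shows "cell (astep (act M) (q, t, h)) j =
    rule M (cell (q, t, h) (j - 1)) (cell (q, t, h) j) (cell (q, t, h) (j + 1))"
proof -
  obtain q' s' d where act: "act M q (t h) = (q', s', d)" by (cases "act M q (t h)")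
  with assms have "d = -1 \<or> d = 0 \<or> d = 1" by auto
  then show ?thesis
    by (elim disjE; cases "h = j"; cases "h = j - 1"; cases "h = j + 1")
       (use act in \<open>auto simp: astep_def cell_def rule_def departing_def head_of_def state_of_def tape_of_def\<close>)
qed

text \<open>The successor keeps 0 free for the marker atom.\<close>

definition letter_code :: "nat option \<times> nat \<Rightarrow> nat" where
  "letter_code a = Suc (to_nat a)"

definition letter_decode :: "nat \<Rightarrow> nat option \<times> nat" where
  "letter_decode n = from_nat (n - 1)"

lemma letter_decode_code [simp]: "letter_decode (letter_code a) = a"
  by (simp add: letter_code_def letter_decode_def)

lemma letter_code_neq_0 [simp]: "letter_code a \<noteq> 0" "0 \<noteq> letter_code a"
  by (simp_all add: letter_code_def)

definition rule_code :: "tm \<Rightarrow> nat \<Rightarrow> nat \<Rightarrow> nat \<Rightarrow> nat" where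
  "rule_code M a b c = letter_code (rule M (letter_decode a) (letter_decode b) (letter_decode c))"

definition accepting_letter :: "nat \<Rightarrow> bool" where
  "accepting_letter a \<longleftrightarrow> fst (letter_decode a) = Some 1"

definition alphabet :: "tm \<Rightarrow> nat list" where
  "alphabet M = map letter_code
     (List.product (None # map Some [0..<Suc (nstates M)]) [0..<nsyms M])"

text \<open>Column \<open>i\<close> of a row shows tape cell \<open>i - (b + 1)\<close>. The row
  thus extends beyond the cells from \<open>-b\<close> to \<open>b\<close> on both sides, so its end
  columns never carry the head.\<close>

definition initial_letters :: "tm \<Rightarrow> nat \<Rightarrow> bool list \<Rightarrow> nat list" where
  "initial_letters M b w = replicate b (letter_code (None, 0)) @ [letter_code (Some (nstates M), 0)] @
     map (\<lambda>x. letter_code (None, bit_sym x)) w @ replicate (b + 2) (letter_code (None, 0))"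

lemma length_initial_letters: "length (initial_letters M b w) = 2 * b + length w + 3"
  by (simp add: initial_letters_def)

lemma initial_letters_nth:
  assumes "p < 2 * b + length w + 3"
  shows "initial_letters M b w ! p =
    letter_code (cell (nstates M, tape_of (init_config w), -1) (int p - int (b + 1)))"
proof -
  consider "p < b" | "p = b" | "b < p" "p < b + 1 + length w" | "b + 1 + length w \<le> p" by linarith
  then show ?thesis
  proof cases
    case 3
    then have "nat (int p - int (b + 1)) = p - (b + 1)" by linarith
    with 3 show ?thesis
      by (auto simp: initial_letters_def nth_append cell_def head_of_def state_of_def tape_of_def init_config_def)
  next
    case 4
    then have "p - b - Suc (length w) < b + 2" using assms by linarith
    with 4 show ?thesis
      by (auto simp: initial_letters_def nth_append nth_Cons' cell_def head_of_def state_of_def tape_of_def init_config_def)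
  qed (auto simp: initial_letters_def nth_append cell_def head_of_def state_of_def tape_of_def init_config_def)
qed

text \<open>The bound holds for all times, including those after halting; \<open>b_pos\<close> makes
  room for the extra initial position at cell -1.\<close>

locale space_bounded_run =
  fixes M :: tm and w :: "bool list" and b :: nat
  assumes wf: "wf_tm M" and b_pos: "1 \<le> b" and bounded: "\<And>m. \<bar>head_of (run M m w)\<bar> \<le> int b"
begin

definition conf :: "nat \<Rightarrow> config" where
  "conf t = (astep (act M) ^^ t) (nstates M, tape_of (init_config w), -1)"

definition width :: nat where
  "width = 2 * b + length w + 3"

definition run_word :: "nat \<Rightarrow> nat" where
  "run_word p = letter_code (cell (conf (p div width)) (int (p mod width) - int (b + 1)))"

lemma width_pos: "0 < width"
  by (simp add: width_def)

lemma act_closed: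
  assumes "q \<le> nstates M" "s < nsyms M"
  shows "fst (act M q s) < nstates M" "fst (snd (act M q s)) < nsyms M" "snd (snd (act M q s)) \<in> {-1, 0, 1}"
proof -
  have "case delta M q s of (q', s', d) \<Rightarrow> q' < nstates M \<and> s' < nsyms M \<and> d \<in> {-1, 0, 1}"
    if "q < nstates M" using that assms(2) wf by (auto simp: wf_tm_def)
  moreover have "3 \<le> nstates M" using wf by (simp add: wf_tm_def)
  ultimately show "fst (act M q s) < nstates M" "fst (snd (act M q s)) < nsyms M"
      "snd (snd (act M q s)) \<in> {-1, 0, 1}"
    using assms by (auto simp: act_def split: prod.splits)
qed

lemma init_tape_bounded: "tape_of (init_config w) j < nsyms M"
  using wf by (auto simp: wf_tm_def tape_of_def init_config_def bit_sym_def)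

lemma conf_bounded: "state_of (conf t) \<le> nstates M \<and> (\<forall>j. tape_of (conf t) j < nsyms M)"
proof (induction t)
  case 0
  then show ?case by (simp add: conf_def state_of_def tape_of_def init_tape_bounded[unfolded tape_of_def])
next
  case (Suc t)
  obtain q tp h where c: "conf t = (q, tp, h)" by (cases "conf t")
  with Suc have "q \<le> nstates M" "tp h < nsyms M" "\<forall>j. tp j < nsyms M"
    by (auto simp: state_of_def tape_of_def)
  moreover have "conf (Suc t) = astep (act M) (q, tp, h)" using c by (simp add: conf_def)
  ultimately show ?case
    using act_closed[of q "tp h"] by (auto simp: astep_def state_of_def tape_of_def split: prod.splits)
qed

lemma conf_Suc_eq_run: "conf (Suc t) = run M t w"
proof (induction t)
  case 0
  \<comment> \<open>The additional state writes back what it reads, so its single step only moves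
    the head to cell 0.\<close>
  have "(tape_of (init_config w))(-1 := tape_of (init_config w) (-1)) = tape_of (init_config w)" by simp
  then show ?case
    by (simp add: conf_def run_def astep_def act_def) (simp add: init_config_def tape_of_def)
next
  case (Suc t)
  have *: "conf (Suc (Suc t)) = astep (act M) (conf (Suc t))" by (simp add: conf_def)
  obtain q tp h where c: "conf (Suc t) = (q, tp, h)" by (cases "conf (Suc t)")
  obtain q0 tp0 h0 where c0: "conf t = (q0, tp0, h0)" by (cases "conf t")
  have "conf (Suc t) = astep (act M) (q0, tp0, h0)" using c0 by (simp add: conf_def)
  then have "q = fst (act M q0 (tp0 h0))" using c by (auto simp: astep_def split: prod.splits)
  \<comment> \<open>The additional state is never entered again, hence \<open>act\<close> agrees
    with \<open>step\<close> from here on.\<close>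
  then have "q < nstates M"
    using act_closed(1)[of q0 "tp0 h0"] conf_bounded[of t] c0 by (simp add: state_of_def tape_of_def)
  then have "astep (act M) (q, tp, h) = step M (q, tp, h)"
    by (auto simp: astep_def act_def step_def)
  with * c Suc.IH show ?case by (simp add: run_def)
qed

lemma head_conf: "\<bar>head_of (conf t)\<bar> \<le> int b"
proof (cases t)
  case 0
  then show ?thesis using b_pos by (simp add: conf_def head_of_def)
next
  case (Suc t')
  then show ?thesis using bounded conf_Suc_eq_run by simp
qed

lemma cell_conf_Suc:
  "cell (conf (Suc t)) j = rule M (cell (conf t) (j - 1)) (cell (conf t) j) (cell (conf t) (j + 1))"
proof -
  obtain q tp h where c: "conf t = (q, tp, h)" by (cases "conf t")
  have "snd (snd (act M q (tp h))) \<in> {-1, 0, 1}"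
    by (rule act_closed(3)) (use conf_bounded[of t] c in \<open>auto simp: state_of_def tape_of_def\<close>)
  from cell_astep[of M q tp h j, OF this] show ?thesis using c by (simp add: conf_def)
qed

lemma no_head_outside: "j < - int b \<or> int b < j \<Longrightarrow> fst (cell (conf t) j) = None"
  using head_conf[of t] by (auto simp: cell_def)

text \<open>At the ends of a row the neighbour in the word belongs to the previous or the next row; this is
  harmless because neither it nor the true neighbour carries the head.\<close>

lemma run_word_rule:
  "run_word (p + (width + 1)) = rule_code M (run_word p) (run_word (p + 1)) (run_word (p + 2))"
proof -
  \<comment> \<open>Row and column of the middle of the window; the new letter stands in the same
    column one row later.\<close>
  define t i where "t = (p + 1) div width" and "i = (p + 1) mod width"
  define j where "j = int i - int (b + 1)"
  have i: "i < width" by (simp add: i_def width_pos)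
  have p: "p + 1 = t * width + i" by (simp only: t_def i_def div_mult_mod_eq)
  have at: "run_word (t' * width + i') = letter_code (cell (conf t') (int i' - int (b + 1)))"
    if "i' < width" for t' i' using that by (simp add: run_word_def)
  have 1: "run_word (p + (width + 1)) = letter_code (cell (conf (Suc t)) j)"
  proof -
    have eq: "p + (width + 1) = Suc t * width + i" using p by simp
    show ?thesis unfolding eq j_def by (rule at[OF i])
  qed
  have 2: "run_word (p + 1) = letter_code (cell (conf t) j)"
    using at[OF i, of t] p by (simp add: j_def)
  obtain l where l: "run_word p = letter_code l"
    "l = cell (conf t) (j - 1) \<or> fst l = None \<and> fst (cell (conf t) (j - 1)) = None"
  proof (cases "i = 0")
    case True
    with p obtain t' where t': "t = Suc t'" by (cases t) auto
    with p True have "p = t' * width + (width - 1)" using width_pos by simp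
    then have "run_word p = letter_code (cell (conf t') (int (width - 1) - int (b + 1)))"
      using at[of "width - 1" t'] width_pos by simp
    moreover have "fst (cell (conf t') (int (width - 1) - int (b + 1))) = None"
      by (rule no_head_outside) (simp add: width_def)
    moreover have "fst (cell (conf t) (j - 1)) = None"
      by (rule no_head_outside) (simp add: j_def True)
    ultimately show ?thesis using that by blast
  next
    case False
    then have "p = t * width + (i - 1)" using p by simp
    then have "run_word p = letter_code (cell (conf t) (j - 1))"
      using at[of "i - 1" t] i False by (simp add: j_def of_nat_diff algebra_simps)
    then show ?thesis using that by blast
  qed
  obtain r where r: "run_word (p + 2) = letter_code r"
    "r = cell (conf t) (j + 1) \<or> fst r = None \<and> fst (cell (conf t) (j + 1)) = None"
  proof (cases "i = width - 1")
    case True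
    then have "p + 2 = Suc t * width + 0" using p width_pos by simp
    then have "run_word (p + 2) = letter_code (cell (conf (Suc t)) (- int (b + 1)))"
      using at[of 0 "Suc t"] width_pos by simp
    moreover have "fst (cell (conf (Suc t)) (- int (b + 1))) = None"
      by (rule no_head_outside) simp
    moreover have "fst (cell (conf t) (j + 1)) = None"
      by (rule no_head_outside) (simp add: j_def True width_def)
    ultimately show ?thesis using that by blast
  next
    case False
    have "p + 2 = t * width + (i + 1)" using p by simp
    then have "run_word (p + 2) = letter_code (cell (conf t) (j + 1))"
      using at[of "i + 1" t] i False by (simp add: j_def algebra_simps)
    then show ?thesis using that by blast
  qed
  have "rule M l (cell (conf t) j) r = cell (conf (Suc t)) j"
    unfolding cell_conf_Suc using l(2) r(2) by (intro rule_cong_outer) auto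
  then show ?thesis unfolding 1 2 l(1) r(1) rule_code_def by simp
qed

lemma run_word_in_alphabet: "range run_word \<subseteq> set (alphabet M)"
proof -
  have "cell (conf t) j \<in> (insert None (Some ` {0..<Suc (nstates M)})) \<times> {0..<nsyms M}" for t j
    using conf_bounded[of t] by (auto simp: cell_def)
  moreover have "set (alphabet M) =
      letter_code ` ((insert None (Some ` {0..<Suc (nstates M)})) \<times> {0..<nsyms M})"
    by (simp only: alphabet_def set_map set_product list.set set_upt)
  ultimately show ?thesis unfolding run_word_def by blast
qed

text \<open>The local rule reaches back \<open>width + 1\<close> positions, so besides the first row
  one more letter must be prescribed, namely the blank opening the second row.\<close>

lemma run_word_initial:
  "p < width \<Longrightarrow> run_word p = initial_letters M b w ! p" "run_word width = letter_code (None, 0)"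
proof -
  show "run_word p = initial_letters M b w ! p" if "p < width"
    using that by (simp add: run_word_def initial_letters_nth width_def conf_def)
  have "run_word width = letter_code (cell (conf 1) (- int (b + 1)))"
    using width_pos by (simp add: run_word_def)
  also have "conf 1 = init_config w" using conf_Suc_eq_run[of 0] by (simp add: run_def)
  finally show "run_word width = letter_code (None, 0)"
    by (simp add: cell_def head_of_def tape_of_def init_config_def)
qed

lemma ex_accepting_letter_iff: "(\<exists>p. accepting_letter (run_word p)) \<longleftrightarrow> (\<exists>m. state_of (run M m w) = 1)"
proof
  assume "\<exists>p. accepting_letter (run_word p)"
  then obtain t j where "fst (cell (conf t) j) = Some 1" by (auto simp: accepting_letter_def run_word_def)
  then have 1: "state_of (conf t) = 1" by (auto simp: cell_def split: if_splits)
  moreover have "t \<noteq> 0"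
  proof
    assume "t = 0"
    \<comment> \<open>The additional state is at least 3, hence different from 1.\<close>
    with 1 wf show False by (simp add: conf_def state_of_def wf_tm_def)
  qed
  then obtain m where "t = Suc m" by (cases t) auto
  ultimately show "\<exists>m. state_of (run M m w) = 1" using conf_Suc_eq_run by auto
next
  assume "\<exists>m. state_of (run M m w) = 1"
  then obtain t where t: "state_of (conf t) = 1" using conf_Suc_eq_run by metis
  \<comment> \<open>The column of the head, which lies inside the row by the space bound.\<close>
  define i where "i = nat (head_of (conf t) + int (b + 1))"
  have i: "int i = head_of (conf t) + int (b + 1)" "i < width"
    using head_conf[of t] by (auto simp: i_def width_def)
  have "run_word (t * width + i) = letter_code (cell (conf t) (head_of (conf t)))"
    using i by (simp add: run_word_def)
  with t have "accepting_letter (run_word (t * width + i))" by (simp add: accepting_letter_def cell_def)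
  then show "\<exists>p. accepting_letter (run_word p)" by blast
qed

text \<open>The prescribed letters and the local rule determine the word by strong induction on the
  position, so \<open>run_word\<close> is the only candidate.\<close>

lemma ex_accepting_word_iff:
  "(\<exists>x. range x \<subseteq> set (alphabet M) \<and> accepting_word (rule_code M) accepting_letter
       (initial_letters M b w) (letter_code (None, 0)) (2 * b + length w + 4) x)
   \<longleftrightarrow> (\<exists>m. state_of (run M m w) = 1)"
proof -
  have len: "length (initial_letters M b w) = width" "2 * b + length w + 4 = width + 1"
    by (simp_all add: length_initial_letters width_def)
  have "x = run_word"
    if x: "\<forall>p<width. x p = initial_letters M b w ! p" "x width = letter_code (None, 0)"
      "\<forall>p. x (p + (width + 1)) = rule_code M (x p) (x (p + 1)) (x (p + 2))" for x
  proof
    fix p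
    show "x p = run_word p"
    proof (induction p rule: less_induct)
      case (less p)
      consider "p < width" | "p = width" | "width + 1 \<le> p" by linarith
      then show ?case
      proof cases
        case 3
        then obtain n where n: "p = n + (width + 1)" by (metis add.commute le_Suc_ex)
        then have "n < p" "n + 1 < p" "n + 2 < p" by (auto simp: width_def)
        with less.IH x(3) run_word_rule[of n] n show ?thesis by simp
      qed (use x run_word_initial in auto)
    qed
  qed
  then show ?thesis
    unfolding accepting_word_def len ex_accepting_letter_iff[symmetric]
    using run_word_in_alphabet run_word_initial run_word_rule by blast
qed

end

section \<open>Halted runs, the reduction and its emission\<close>

lemma run_add: "run M (m + n) w = (step M ^^ m) (run M n w)"
  by (simp add: run_def funpow_add)

lemma run_halted:
  assumes "state_of (run M n w) \<in> {1, 2}" "n \<le> m"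
  shows "run M m w = run M n w"
proof -
  have fix_point: "step M (run M n w) = run M n w"
    using assms(1) by (auto simp: step_def state_of_def split: prod.splits)
  have "(step M ^^ d) (run M n w) = run M n w" for d
    by (induction d) (simp_all add: fix_point)
  then show ?thesis using run_add[of M "m - n" n w] assms(2) by simp
qed

text \<open>Here \<open>m\<close> is the row width plus one, and \<open>z\<close> is the blank with
  which the second row begins.\<close>

definition reduction :: "tm \<Rightarrow> nat \<Rightarrow> nat \<Rightarrow> bool list \<Rightarrow> tht" where
  "reduction M c k w = (let b = c * length w ^ k + c; as = initial_letters M b w; z = letter_code (None, 0);
       m = 2 * b + length w + 4; \<Sigma> = alphabet M
     in minimality_test \<Sigma> (run_formula \<Sigma> (rule_code M) accepting_letter as z m)
          (no_run_formula \<Sigma> (rule_code M) accepting_letter as z m))"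

lemma emittable_formula_reduction: "emittable_formula (reduction M c k)"
proof -
  have rep: "emittable (\<lambda>w. concat (map block (replicate (m w) a)))" if "emittable_count m" for m block a
    using that by (simp add: emittable_count_def map_replicate)
  have letters: "emittable (\<lambda>w. concat (map block (map (\<lambda>x. letter_code (None, bit_sym x)) w)))" for block
    using emittable_bits[of "block (letter_code (None, 2))" "block (letter_code (None, 1))"]
    by (simp add: comp_def bit_sym_def if_distrib cong: if_cong)
  have "emittable (\<lambda>w. concat (map block (initial_letters M (c * length w ^ k + c) w)))" for block
    unfolding initial_letters_def map_append concat_append
    by (intro emittable_append rep letters emittable_const emittable_count_add emittable_count_power
        emittable_count_const)
  \<comment> \<open>Doubling is written as a sum because closure of counts is available for
    addition.\<close>
  moreover have "emittable_count (\<lambda>w. (c * length w ^ k + c) + (c * length w ^ k + c) + length w + 4)"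
    by (intro emittable_count_add emittable_count_power emittable_count_length emittable_count_const)
  then have "emittable_count (\<lambda>w. 2 * (c * length w ^ k + c) + length w + 4)"
    by (simp only: mult_2)
  ultimately show ?thesis
    unfolding reduction_def Let_def by (rule emittable_formula_minimality_test_run)
qed

lemma implication_free_reduction: "implication_free (reduction M c k w)"
  by (auto simp: reduction_def Let_def minimality_test_def implication_free_run_formula
      implication_free_no_run_formula)

section \<open>Unique readability of the encoding\<close>

lemma tag_eq_iff: "tag i @ u = tag j @ v \<longleftrightarrow> i = j \<and> u = v"
proof (induction i arbitrary: j)
  case 0
  then show ?case by (cases j) (auto simp: tag_def)
next
  case (Suc i)
  then show ?case by (cases j) (auto simp: tag_def)
qed

lemma nat_code_0: "nat_code 0 = [False]"
  by (subst nat_code.simps) simp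

lemma nat_code_pos: "n \<noteq> 0 \<Longrightarrow> nat_code n = True # odd n # nat_code (n div 2)"
  by (subst nat_code.simps) simp

text \<open>Each binary digit is announced by \<open>True\<close> and the end by
  \<open>False\<close>, so the code shows where it stops.\<close>

lemma nat_code_append_inj: "nat_code m @ u = nat_code n @ v \<Longrightarrow> m = n \<and> u = v"
proof (induction m arbitrary: n rule: less_induct)
  case (less m)
  show ?case
  proof (cases "m = 0 \<or> n = 0")
    case True
    then show ?thesis
      using less.prems by (cases "m = 0"; cases "n = 0") (auto simp: nat_code_0 nat_code_pos)
  next
    case False
    with less.prems have "odd m = odd n" "nat_code (m div 2) @ u = nat_code (n div 2) @ v"
      by (simp_all add: nat_code_pos)
    moreover from this False have "m div 2 = n div 2 \<and> u = v" by (intro less.IH) auto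
    ultimately show ?thesis by (metis bit_eq_rec)
  qed
qed

text \<open>The arbitrary suffixes carry the induction through binary connectives, where the code of
  the second argument follows that of the first.\<close>

lemma enc_append_inj: "enc \<phi> @ u = enc \<psi> @ v \<Longrightarrow> \<phi> = \<psi> \<and> u = v"
proof (induction \<phi> arbitrary: \<psi> u v)
  case (Atom p)
  then show ?case by (cases \<psi>) (auto simp: tag_eq_iff dest: nat_code_append_inj)
next
  case Bot
  then show ?case by (cases \<psi>) (auto simp: tag_eq_iff)
next
  case (Or a b)
  from Or.prems show ?case by (cases \<psi>) (auto simp: tag_eq_iff dest!: Or.IH)
next
  case (And a b)
  from And.prems show ?case by (cases \<psi>) (auto simp: tag_eq_iff dest!: And.IH)
next
  case (Imp a b)
  from Imp.prems show ?case by (cases \<psi>) (auto simp: tag_eq_iff dest!: Imp.IH)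
next
  case (Next a)
  from Next.prems show ?case by (cases \<psi>) (auto simp: tag_eq_iff dest!: Next.IH)
next
  case (Until a b)
  from Until.prems show ?case by (cases \<psi>) (auto simp: tag_eq_iff dest!: Until.IH)
next
  case (Release a b)
  from Release.prems show ?case by (cases \<psi>) (auto simp: tag_eq_iff dest!: Release.IH)
next
  case (Fin a)
  from Fin.prems show ?case by (cases \<psi>) (auto simp: tag_eq_iff dest!: Fin.IH)
next
  case (Glob a)
  from Glob.prems show ?case by (cases \<psi>) (auto simp: tag_eq_iff dest!: Glob.IH)
qed

lemma inj_enc: "inj enc"
  using enc_append_inj[of _ "[]" _ "[]"] by (auto simp: inj_def)

lemma enc_reduction_in_CON_THT0_iff:
  assumes "wf_tm M" and "1 \<le> c"
    and n: "state_of (run M n w) \<in> {1, 2}" "\<forall>m \<le> n. \<bar>head_of (run M m w)\<bar> \<le> int (c * length w ^ k + c)"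
  shows "enc (reduction M c k w) \<in> CON_THT0 \<longleftrightarrow> state_of (run M n w) = 1"
proof -
  interpret space_bounded_run M w "c * length w ^ k + c"
  proof
    show "\<bar>head_of (run M m w)\<bar> \<le> int (c * length w ^ k + c)" for m
      \<comment> \<open>After halting the configuration no longer changes, which extends the space
        bound to all times.\<close>
      using n run_halted[OF n(1), of m] by (cases "m \<le> n") auto
  qed (use assms in auto)
  have "enc (reduction M c k w) \<in> CON_THT0 \<longleftrightarrow> (\<exists>T. equilibrium_model T (reduction M c k w))"
    using implication_free_reduction[of M c k w] by (auto simp: CON_THT0_def dest: injD[OF inj_enc])
  also have "\<dots> \<longleftrightarrow> (\<exists>m. state_of (run M m w) = 1)"
    unfolding reduction_def Let_def ex_accepting_word_iff[symmetric]
    by (rule ex_equilibrium_model_run_formula_iff)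
       (auto simp: alphabet_def initial_letters_def rule_code_def)
  also have "\<dots> \<longleftrightarrow> state_of (run M n w) = 1"
  proof
    assume "\<exists>m. state_of (run M m w) = 1"
    then obtain m where m: "state_of (run M m w) = 1" by blast
    \<comment> \<open>Both times are halting times, so the two configurations coincide with the one
      at the later time.\<close>
    have "run M (max m n) w = run M m w" "run M (max m n) w = run M n w"
      using run_halted[of M m w "max m n"] run_halted[of M n w "max m n"] m n(1) by auto
    with m show "state_of (run M n w) = 1" by simp
  qed blast
  finally show ?thesis .
qed

theorem mainTheorem7:
  shows "PSPACE_hard CON_THT0"
  unfolding PSPACE_hard_def
proof
  fix L
  assume "L \<in> PSPACE"
  then obtain M c k where wf: "wf_tm M" and decides: "\<forall>w. \<exists>n. state_of (run M n w) \<in> {1, 2} \<and>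
      (state_of (run M n w) = 1 \<longleftrightarrow> w \<in> L) \<and>
      (\<forall>m \<le> n. \<bar>head_of (run M m w)\<bar> \<le> int (c * length w ^ k + c))"
    unfolding PSPACE_def by blast
  \<comment> \<open>Passing from \<open>c\<close> to \<open>Suc c\<close> makes the space bound
    positive, as the extra initial position at cell -1 requires.\<close>
  have "w \<in> L \<longleftrightarrow> enc (reduction M (Suc c) k w) \<in> CON_THT0" for w
  proof -
    obtain n where n: "state_of (run M n w) \<in> {1, 2}" "state_of (run M n w) = 1 \<longleftrightarrow> w \<in> L"
      and bound: "\<forall>m \<le> n. \<bar>head_of (run M m w)\<bar> \<le> int (c * length w ^ k + c)"
      using decides by blast
    have "int (c * length w ^ k + c) \<le> int (Suc c * length w ^ k + Suc c)" by simp
    with bound have "\<forall>m \<le> n. \<bar>head_of (run M m w)\<bar> \<le> int (Suc c * length w ^ k + Suc c)"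
      by (meson order_trans)
    from enc_reduction_in_CON_THT0_iff[OF wf _ n(1) this] n(2) show ?thesis by simp
  qed
  moreover have "poly_time_computable (\<lambda>w. enc (reduction M (Suc c) k w))"
    using emittable_formula_reduction[of M "Suc c" k] unfolding emittable_formula_def
    by (rule poly_time_computable_if_emittable)
  ultimately show "poly_reducible L CON_THT0" unfolding poly_reducible_def by blast
qed

end
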